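(* Let $(Z_k)_{k\in\mathbb Z_+}$ be the embedded process of the simple harmonic urn. Let $n\in\mathbb N$. Then $$\mathbb E[Z_{k+1}\mid Z_k=n]=n+\tfrac23+O(e^{\alpha_1 n})$$ as $n\to\infty$, where $\alpha_1+\beta_1 i=-(2.088843\dots)+(7.461489\dots)i$ is a root of $\lambda-1+e^{-\lambda}=0$.
   Context: $\mathbb Z_+=\{0,1,2,\dots\}$, $\mathbb N=\{1,2,\dots\}$, and $\operatorname{sgn}(x)=-1,0,1$ according as $x<0$, $x=0$, $x>0$. The simple harmonic urn process $(X_n,Y_n)_{n\in\mathbb Z_+}$ is the Markov chain on $\mathbb Z^2\setminus\{(0,0)\}$ with $(X_0,Y_0)=(z_0,0)$, $z_0\in\mathbb N$, and transition law: given $(X_n,Y_n)=(x,y)$, $$(X_{n+1},Y_{n+1})=\begin{cases}(x,y+\operatorname{sgn}(x)) & \text{with probability } \frac{|x|}{|x|+|y|},\\ (x-\operatorname{sgn}(y),y) & \text{with probability } \frac{|y|}{|x|+|y|}.\end{cases}$$ Set $\nu_0=0$ and $\nu_k=\min\{n>\nu_{k-1}: X_nY_n=0\}$ for $k\in\mathbb N$ (almost surely finite). Set $Z_0=z_0$ and $Z_k=|X_{\nu_k}|+|Y_{\nu_k}|$ for $k\in\mathbb N$; $(Z_k)$ is a time-homogeneous irreducible Markov chain on $\mathbb N$, so the conditional expectation does not depend on $k$. The nonzero roots of $\lambda-1+e^{-\lambda}=0$ occur in complex conjugate pairs, and $\alpha_1$ is the largest real part among the nonzero roots. *)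

theory Defs
  imports "HOL-Probability.Probability" "HOL-Library.Landau_Symbols"
begin

(* At the excluded state (0,0) both summands are 0, because x / 0 = 0; that state is
   reached with probability 0 by a process started at (z0,0).  When x = 0 or y = 0,
   one of the two branches has probability 0. *)
definition urn_kernel :: "int \<times> int \<Rightarrow> int \<times> int \<Rightarrow> real" where
  "urn_kernel s t = (case s of (x, y) \<Rightarrow>
     (if t = (x, y + sgn x) then real_of_int \<bar>x\<bar> / real_of_int (\<bar>x\<bar> + \<bar>y\<bar>) else 0) +
     (if t = (x - sgn y, y) then real_of_int \<bar>y\<bar> / real_of_int (\<bar>x\<bar> + \<bar>y\<bar>) else 0))"

locale simple_harmonic_urn = prob_space M
  for M :: "'a measure" +
  fixes z0 :: nat and X Y :: "nat \<Rightarrow> 'a \<Rightarrow> int"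
  assumes z0_pos: "z0 \<ge> 1"
    and X_measurable: "\<And>n. X n \<in> measurable M (count_space UNIV)"
    and Y_measurable: "\<And>n. Y n \<in> measurable M (count_space UNIV)"
    and start: "AE \<omega> in M. (X 0 \<omega>, Y 0 \<omega>) = (int z0, 0)"
    and markov: "\<And>n s t. \<P>(\<omega> in M. \<forall>i\<le>n. (X i \<omega>, Y i \<omega>) = s i) > 0 \<Longrightarrow>
      \<P>(\<omega> in M. (X (Suc n) \<omega>, Y (Suc n) \<omega>) = t \<bar> \<forall>i\<le>n. (X i \<omega>, Y i \<omega>) = s i)
        = urn_kernel (s n) t"

(* LEAST is unspecified when the axes are never hit again, an event of probability 0. *)
primrec axis_time :: "(nat \<Rightarrow> 'a \<Rightarrow> int) \<Rightarrow> (nat \<Rightarrow> 'a \<Rightarrow> int) \<Rightarrow> nat \<Rightarrow> 'a \<Rightarrow> nat" where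
  "axis_time X Y 0 \<omega> = 0"
| "axis_time X Y (Suc k) \<omega> = (LEAST n. n > axis_time X Y k \<omega> \<and> X n \<omega> * Y n \<omega> = 0)"

(* For k = 0 this is |X 0| + |Y 0|, i.e. z0 almost surely. *)
definition embedded :: "(nat \<Rightarrow> 'a \<Rightarrow> int) \<Rightarrow> (nat \<Rightarrow> 'a \<Rightarrow> int) \<Rightarrow> nat \<Rightarrow> 'a \<Rightarrow> nat" where
  "embedded X Y k \<omega> =
     nat (\<bar>X (axis_time X Y k \<omega>) \<omega>\<bar> + \<bar>Y (axis_time X Y k \<omega>) \<omega>\<bar>)"

definition event_expectation :: "'a measure \<Rightarrow> ('a \<Rightarrow> real) \<Rightarrow> 'a set \<Rightarrow> real" where
  "event_expectation M f A = (LINT \<omega>:A|M. f \<omega>) / measure M A"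

definition char_roots :: "complex set" where
  "char_roots = {l. l \<noteq> 0 \<and> l - 1 + exp (- l) = 0}"

end

theory Submission
  imports Defs "HOL-Complex_Analysis.Complex_Analysis"
begin

text \<open>
  Give the coordinate that decreases within a quadrant the rate \<open>1 / x\<close> in state \<open>x\<close>, and the increasing one the
  rate \<open>1 / y\<close> in state \<open>y\<close>. The two become independent, and the chain started at \<open>n\<close> exceeds \<open>m\<close> in its next
  state with probability \<open>P (\<Sum>j=1..m. j * \<zeta>\<^sub>j < \<Sum>i=1..n. i * \<xi>\<^sub>i)\<close> for independent exponential variables. Its
  closed form solves the recurrence of the exit probabilities and equals the probability that \<open>n + m\<close> uniform
  variables have sum at most \<open>n\<close>. Hence the conditional expectation is \<open>M n - n\<close>, where \<open>M\<close> is the renewal function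
  of the uniform law, with \<open>\<Sum>n. M n * z ^ n = 1 / (1 - z * exp (1 - z))\<close>. The double pole at \<open>z = 1\<close> contributes
  \<open>2 * n + 2 / 3\<close>. All other poles are simple and of the form \<open>z = 1 - l = exp (- l)\<close> with \<open>l\<close> a nonzero root of
  \<open>l - 1 + exp (- l) = 0\<close>, so the nearest one contributes a term of order \<open>exp (\<alpha>\<^sub>1 * n)\<close>.
\<close>

section \<open>The generating function\<close>

text \<open>The expected number of independent uniform variables on \<open>[0, 1]\<close> needed for their sum to exceed \<open>n\<close>.\<close>
definition renewal_coeff :: "nat \<Rightarrow> real" where
  "renewal_coeff n = (\<Sum>i\<le>n. exp (real i) * (- real i) ^ (n - i) / fact (n - i))"

definition renewal_denom :: "complex \<Rightarrow> complex" where
  "renewal_denom z = 1 - z * exp (1 - z)"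

lemma renewal_denom_shift_expansion:
  "(\<lambda>t. renewal_denom (a + t)) has_fps_expansion
    1 - (fps_const a + fps_X) * (fps_const (exp (1 - a)) * fps_exp (-1))"
proof -
  have "renewal_denom (a + t) = 1 - (a + t) * (exp (1 - a) * exp (- t))" for t
    by (simp add: renewal_denom_def diff_diff_add flip: exp_add)
  then show ?thesis
    by (auto intro!: fps_expansion_intros)
qed

text \<open>Powers of \<open>fps_X * h\<close> above the n-th only have terms of degree above n, so
  the geometric series may be cut off at n.\<close>

lemma nth_inverse_one_minus_X_mult:
  fixes h :: "'a :: field fps"
  shows "fps_nth (inverse (1 - fps_X * h)) n = (\<Sum>i\<le>n. fps_nth (h ^ i) (n - i))"
proof -
  define A where "A = fps_X * h"
  have "inverse (1 - A) * (1 - A) = 1"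
    by (rule inverse_mult_eq_1) (simp add: A_def)
  moreover have "(1 - A) * (\<Sum>i\<le>n. A ^ i) = 1 - A ^ Suc n"
    by (rule sum_gp_basic)
  ultimately have "(\<Sum>i\<le>n. A ^ i) = inverse (1 - A) * (1 - A ^ Suc n)"
    by (metis mult.assoc mult_1)
  then have "inverse (1 - A) = (\<Sum>i\<le>n. A ^ i) + fps_X ^ Suc n * (h ^ Suc n * inverse (1 - A))"
    by (simp add: A_def power_mult_distrib algebra_simps)
  then have "fps_nth (inverse (1 - A)) n
      = (\<Sum>i\<le>n. fps_nth (A ^ i) n) + fps_nth (fps_X ^ Suc n * (h ^ Suc n * inverse (1 - A))) n"
    by (metis fps_add_nth fps_sum_nth)
  also have "fps_nth (fps_X ^ Suc n * (h ^ Suc n * inverse (1 - A))) n = 0"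
    unfolding fps_X_power_mult_nth by simp
  finally show ?thesis
    by (simp add: A_def power_mult_distrib fps_X_power_mult_nth)
qed

text \<open>Here \<open>renewal_denom z = 1 - z * h z\<close> with
  \<open>h z = exp 1 * exp (- z)\<close>, and the powers of h are exponentials again.\<close>

lemma renewal_denom_inverse_expansion:
  "(\<lambda>z. inverse (renewal_denom z)) has_fps_expansion Abs_fps (\<lambda>n. of_real (renewal_coeff n))"
proof -
  define h :: "complex fps" where "h = fps_const (exp 1) * fps_exp (-1)"
  have "renewal_denom has_fps_expansion 1 - fps_X * h"
    using renewal_denom_shift_expansion[of 0] by (simp add: h_def)
  then have "(\<lambda>z. inverse (renewal_denom z)) has_fps_expansion inverse (1 - fps_X * h)"
    by (rule has_fps_expansion_inverse) simp
  moreover have "fps_nth (h ^ i) (n - i) = of_real (exp (real i) * (- real i) ^ (n - i) / fact (n - i))" for i n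
    by (simp add: h_def power_mult_distrib fps_exp_power_mult fps_const_power flip: exp_of_nat_mult exp_of_real)
  then have "inverse (1 - fps_X * h) = Abs_fps (\<lambda>n. of_real (renewal_coeff n))"
    by (intro fps_ext) (simp add: nth_inverse_one_minus_X_mult renewal_coeff_def)
  ultimately show ?thesis by simp
qed

text \<open>Dividing out the zero of order d leaves an invertible series, whose inverse starts with
  the coefficients \<open>c\<close> and \<open>c'\<close>. For d at most 2 these two determine the
  principal part; \<open>j\<close> is the remainder, with a finite limit at
  \<open>a\<close>.\<close>

lemma inverse_expansion_at_zero:
  fixes f :: "complex \<Rightarrow> complex"
  assumes f: "(\<lambda>t. f (a + t)) has_fps_expansion F"
    and F: "\<And>i. i < d \<Longrightarrow> fps_nth F i = 0" "fps_nth F d \<noteq> 0"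
  defines "c \<equiv> inverse (fps_nth F d)"
  defines "c' \<equiv> - fps_nth F (d + 1) / (fps_nth F d)\<^sup>2"
  shows "\<exists>j L. (j \<longlongrightarrow> L) (at a) \<and>
    (\<forall>\<^sub>F z in at a. inverse (f z) = (c + c' * (z - a) + (z - a)\<^sup>2 * j z) / (z - a) ^ d)"
proof -
  have sub: "subdegree F = d" using F by (intro subdegreeI)
  define u where "u = (\<lambda>t. if t = 0 then fps_nth F d else f (a + t) / t ^ d)"
  define U where "U = fps_shift d F"
  have U: "u has_fps_expansion U"
    unfolding u_def U_def using f sub by (intro has_fps_expansion_shift) auto
  have "fps_nth U 0 \<noteq> 0" by (simp add: U_def F)
  define I where "I = inverse U"
  have I: "(\<lambda>t. inverse (u t)) has_fps_expansion I"
    unfolding I_def by (rule has_fps_expansion_inverse) fact+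
  have I0: "fps_nth I 0 = c" by (simp add: I_def U_def c_def)
  have "fps_nth (U * I) 1 = 0"
    using inverse_mult_eq_1'[OF \<open>fps_nth U 0 \<noteq> 0\<close>] by (simp add: I_def)
  then have "fps_nth U 0 * fps_nth I 1 + fps_nth U 1 * fps_nth I 0 = 0"
    by (simp add: fps_mult_nth)
  then have I1: "fps_nth I 1 = c'"
    using F(2) by (simp add: I0 U_def c_def c'_def field_simps power2_eq_square add_eq_0_iff)
  define J where "J = I - fps_const c - fps_const c' * fps_X"
  have J: "(\<lambda>t. inverse (u t) - c - c' * t) has_fps_expansion J"
    unfolding J_def by (intro fps_expansion_intros I)
  have J2: "fps_nth J i = 0" if "i < 2" for i
    using that I0 I1 by (auto simp: J_def less_2_cases_iff)
  define j where "j = (\<lambda>t. if t = 0 then fps_nth J 2 else (inverse (u t) - c - c' * t) / t ^ 2)"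
  have jexp: "\<exists>K. j has_fps_expansion K"
  \<comment> \<open>The zero series has subdegree 0, so the bound by 2 below is only available for
    nonzero \<open>J\<close>.\<close>
  proof (cases "J = 0")
    case True
    then have "\<forall>\<^sub>F t in nhds 0. inverse (u t) - c - c' * t = 0"
      using J by (simp add: has_fps_expansion_0_iff)
    then have "\<forall>\<^sub>F t in nhds 0. j t = 0"
      by eventually_elim (simp add: j_def True)
    then show ?thesis by (metis has_fps_expansion_0_iff)
  next
    case False
    then have "2 \<le> subdegree J" using J2 by (meson not_le subdegree_geI)
    then show ?thesis
      unfolding j_def using J by (intro exI[of _ "fps_shift 2 J"] has_fps_expansion_shift) auto
  qed
  then have "(j \<longlongrightarrow> j 0) (at 0)"
    using has_fps_expansion_imp_continuous[of j _ UNIV] by (auto simp: continuous_within)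
  then have "((\<lambda>z. j (z - a)) \<longlongrightarrow> j 0) (at a)"
    by (subst at_to_0) (simp add: filterlim_filtermap)
  moreover have "\<forall>\<^sub>F z in at a. inverse (f z) = (c + c' * (z - a) + (z - a)\<^sup>2 * j (z - a)) / (z - a) ^ d"
    unfolding eventually_at_filter
  proof (intro always_eventually allI impI)
    fix z assume "z \<noteq> a"
    then have "inverse (u (z - a)) = c + c' * (z - a) + (z - a)\<^sup>2 * j (z - a)"
      by (simp add: j_def)
    moreover have "inverse (u (z - a)) = (z - a) ^ d * inverse (f z)"
      using \<open>z \<noteq> a\<close> by (simp add: u_def divide_inverse)
    ultimately show "inverse (f z) = (c + c' * (z - a) + (z - a)\<^sup>2 * j (z - a)) / (z - a) ^ d"
      using \<open>z \<noteq> a\<close> by (simp add: field_simps)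
  qed
  ultimately show ?thesis by blast
qed

lemma inverse_simple_zero_bigo:
  fixes f :: "complex \<Rightarrow> complex"
  assumes "(\<lambda>t. f (a + t)) has_fps_expansion F" "fps_nth F 0 = 0" "fps_nth F 1 \<noteq> 0"
  shows "(\<lambda>z. inverse (f z) - inverse (fps_nth F 1) / (z - a)) \<in> O[at a](\<lambda>_. 1)"
proof -
  define c where "c = - fps_nth F 2 / (fps_nth F 1)\<^sup>2"
  obtain j L where j: "(j \<longlongrightarrow> L) (at a)"
    and ev: "\<forall>\<^sub>F z in at a. inverse (f z) =
      (inverse (fps_nth F 1) + c * (z - a) + (z - a)\<^sup>2 * j z) / (z - a) ^ 1"
    using inverse_expansion_at_zero[OF assms(1), of 1] assms(2,3) by (auto simp: c_def simp flip: numeral_2_eq_2)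
  have ne: "\<forall>\<^sub>F z in at a. z \<noteq> a" by (simp add: eventually_at_filter)
  have "((\<lambda>z. c + (z - a) * j z) \<longlongrightarrow> c + (a - a) * L) (at a)"
    by (intro tendsto_intros j)
  then have "((\<lambda>z. inverse (f z) - inverse (fps_nth F 1) / (z - a)) \<longlongrightarrow> c + (a - a) * L) (at a)"
  proof (rule Lim_transform_eventually)
    show "\<forall>\<^sub>F z in at a. c + (z - a) * j z = inverse (f z) - inverse (fps_nth F 1) / (z - a)"
      using ev ne by eventually_elim (auto simp: add_divide_distrib power2_eq_square)
  qed
  then show ?thesis by (intro bigoI_tendsto[where c = "c + (a - a) * L"]) auto
qed

lemma inverse_double_zero_bigo:
  fixes f :: "complex \<Rightarrow> complex"
  assumes "(\<lambda>t. f (a + t)) has_fps_expansion F" "fps_nth F 0 = 0" "fps_nth F 1 = 0" "fps_nth F 2 \<noteq> 0"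
  shows "(\<lambda>z. inverse (f z) - inverse (fps_nth F 2) / (z - a)\<^sup>2 - (- fps_nth F 3 / (fps_nth F 2)\<^sup>2) / (z - a))
    \<in> O[at a](\<lambda>_. 1)"
proof -
  define c where "c = - fps_nth F 3 / (fps_nth F 2)\<^sup>2"
  obtain j L where j: "(j \<longlongrightarrow> L) (at a)"
    and ev: "\<forall>\<^sub>F z in at a. inverse (f z) =
      (inverse (fps_nth F 2) + c * (z - a) + (z - a)\<^sup>2 * j z) / (z - a) ^ 2"
    using inverse_expansion_at_zero[OF assms(1), of 2] assms(2-4)
    by (auto simp: c_def less_2_cases_iff)
  have ne: "\<forall>\<^sub>F z in at a. z \<noteq> a" by (simp add: eventually_at_filter)
  from j have "((\<lambda>z. inverse (f z) - inverse (fps_nth F 2) / (z - a)\<^sup>2 - c / (z - a)) \<longlongrightarrow> L) (at a)"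
  proof (rule Lim_transform_eventually)
    show "\<forall>\<^sub>F z in at a. j z = inverse (f z) - inverse (fps_nth F 2) / (z - a)\<^sup>2 - c / (z - a)"
      using ev ne by eventually_elim (auto simp: add_divide_distrib power2_eq_square)
  qed
  then show ?thesis unfolding c_def by (intro bigoI_tendsto[where c = L]) auto
qed

section \<open>Exit from a quadrant\<close>

text \<open>This is a k-th difference of a monic polynomial of degree k, computed as the coefficient
  of \<open>fps_X ^ k\<close> in \<open>(1 - E) ^ k * fps_exp a\<close>. It is 1 because
  \<open>1 - E\<close> starts with \<open>fps_X\<close>; the binomial theorem expresses it as the
  sum divided by \<open>fact k\<close>.\<close>

lemma alternating_binomial_power_sum:
  fixes a :: real
  shows "(\<Sum>j\<le>k. (-1) ^ j * real (k choose j) * (a - real j) ^ k) = fact k"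
proof -
  define E :: "real fps" where "E = fps_exp (-1)"
  define g where "g = fps_shift 1 (1 - E)"
  have "1 - E = fps_X * g"
    by (rule fps_ext) (auto simp: g_def E_def)
  then have "fps_nth ((1 - E) ^ k * fps_exp a) k = fps_nth (g ^ k * fps_exp a) 0"
    by (simp add: power_mult_distrib mult.assoc fps_X_power_mult_nth)
  also have "\<dots> = 1"
    by (simp add: g_def E_def fps_nth_power_0)
  finally have 1: "fps_nth ((1 - E) ^ k * fps_exp a) k = 1" .
  have "(1 - E) ^ k = (\<Sum>j\<le>k. of_nat (k choose j) * (- E) ^ j)"
    using binomial_ring[of "- E" 1 k] by simp
  moreover have "(- E) ^ j * fps_exp a = fps_const ((-1) ^ j) * fps_exp (a - real j)" for j
  proof -
    have "(- E) ^ j = fps_const ((-1) ^ j) * fps_exp (- real j)"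
      by (subst power_minus) (simp add: E_def fps_exp_power_mult fps_const_neg[symmetric] fps_const_power[symmetric] del: fps_const_neg fps_const_power)
    then show ?thesis by (simp add: mult.assoc fps_exp_add_mult[symmetric])
  qed
  ultimately have "(1 - E) ^ k * fps_exp a = (\<Sum>j\<le>k. fps_const (real (k choose j) * (-1) ^ j) * fps_exp (a - real j))"
    by (simp add: sum_distrib_right mult.assoc fps_of_nat[symmetric] fps_const_mult[symmetric] del: fps_const_mult)
  then have "1 = (\<Sum>j\<le>k. real (k choose j) * (-1) ^ j * ((a - real j) ^ k / fact k))"
    using 1 by (simp add: fps_sum_nth)
  also have "\<dots> = (\<Sum>j\<le>k. (-1) ^ j * real (k choose j) * (a - real j) ^ k) / fact k"
    unfolding sum_divide_distrib by (intro sum.cong) auto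
  finally show ?thesis by (simp add: field_simps)
qed

text \<open>With independent standard exponential variables \<open>\<xi>\<^sub>i\<close>, \<open>\<zeta>\<^sub>j\<close>, the variable
  \<open>\<Sum>i=1..x. i * \<xi>\<^sub>i\<close> is the mixture, with these signed weights, of the exponential laws of rate \<open>1 / i\<close>,
  so that \<open>exit_tail m x y\<close> is the probability that it exceeds \<open>\<Sum>j=y..m. j * \<zeta>\<^sub>j\<close>.\<close>
definition exit_weight :: "nat \<Rightarrow> nat \<Rightarrow> real" where
  "exit_weight x i = (-1) ^ (x - i) * real i ^ x / (fact i * fact (x - i))"

definition exit_tail :: "nat \<Rightarrow> nat \<Rightarrow> nat \<Rightarrow> real" where
  "exit_tail m x y = (\<Sum>i=1..x. exit_weight x i * (\<Prod>j=y..m. real i / (real i + real j)))"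

text \<open>\<open>alternating_binomial_power_sum\<close> with both parameters equal to x, summed in
  reverse order. The term at 0 drops out because x is positive.\<close>

lemma sum_exit_weight:
  assumes "x \<ge> 1"
  shows "(\<Sum>i=1..x. exit_weight x i) = 1"
proof -
  have "fact x = (\<Sum>j\<le>x. (-1) ^ j * real (x choose j) * (real x - real j) ^ x)"
    by (rule alternating_binomial_power_sum[symmetric])
  also have "\<dots> = (\<Sum>j=0..x. (-1) ^ (x - j) * real (x choose (x - j)) * (real x - real (x - j)) ^ x)"
    by (subst sum.atLeastAtMost_rev) (simp add: atMost_atLeast0)
  also have "\<dots> = (\<Sum>j=0..x. fact x * exit_weight x j)"
    by (intro sum.cong) (auto simp: exit_weight_def binomial_fact of_nat_diff mult_ac)
  also have "\<dots> = fact x * (\<Sum>j=0..x. exit_weight x j)" by (simp add: sum_distrib_left)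
  finally have "(\<Sum>j=0..x. exit_weight x j) = 1" by simp
  moreover have "exit_weight x 0 = 0" using assms by (simp add: exit_weight_def)
  ultimately show ?thesis by (simp add: sum.atLeast_Suc_atMost)
qed

lemma exit_tail_0: "exit_tail m 0 y = 0"
  by (simp add: exit_tail_def)

lemma exit_tail_boundary: "x \<ge> 1 \<Longrightarrow> exit_tail m x (Suc m) = 1"
  using sum_exit_weight by (simp add: exit_tail_def)

text \<open>The factor \<open>real i - real (Suc x)\<close> is what the step equation below leaves
  behind; absorbing it turns a weight for \<open>Suc x\<close> into one for
  \<open>x\<close>.\<close>

lemma exit_weight_Suc:
  assumes "i \<le> x"
  shows "exit_weight (Suc x) i * (real i - real (Suc x)) = exit_weight x i * real i"
proof -
  obtain k where k: "x = i + k" using assms le_Suc_ex by blast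
  have "fact (Suc k) = (1 + real k) * fact k" by simp
  then show ?thesis
    unfolding exit_weight_def k by (simp add: Suc_diff_le divide_simps del: fact_Suc) (simp add: algebra_simps)
qed

text \<open>The first-step equation for the probability that the ascending coordinate passes m
  before the descending one vanishes. It is checked term by term in i; the new term at
  \<open>i = Suc x\<close> has factor 0.\<close>

lemma exit_tail_Suc:
  assumes "y \<le> m"
  shows "(real (Suc x) + real y) * exit_tail m (Suc x) y =
    real (Suc x) * exit_tail m (Suc x) (Suc y) + real y * exit_tail m x y"
proof -
  define P where "P i = (\<Prod>j=Suc y..m. real i / (real i + real j))" for i
  have P: "(\<Prod>j=y..m. real i / (real i + real j)) = real i / (real i + real y) * P i" for i
    using assms by (simp add: P_def prod.atLeast_Suc_atMost)
  have "(real (Suc x) + real y) * exit_tail m (Suc x) y - real (Suc x) * exit_tail m (Suc x) (Suc y)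
     = (\<Sum>i=1..Suc x. exit_weight (Suc x) i * ((real (Suc x) + real y) * (real i / (real i + real y)) - real (Suc x)) * P i)"
    unfolding exit_tail_def P P_def[symmetric] sum_distrib_left sum_subtractf[symmetric]
    by (intro sum.cong refl) (simp only: algebra_simps)
  also have "\<dots> = (\<Sum>i=1..Suc x. real y * (exit_weight (Suc x) i * (real i - real (Suc x)) / (real i + real y) * P i))"
  proof (intro sum.cong refl)
    fix i assume "i \<in> {1..Suc x}"
    then have "real i + real y \<noteq> 0" by auto
    then have "(real (Suc x) + real y) * (real i / (real i + real y)) - real (Suc x)
        = real y * (real i - real (Suc x)) / (real i + real y)"
      by (simp add: field_simps)
    then show "exit_weight (Suc x) i * ((real (Suc x) + real y) * (real i / (real i + real y)) - real (Suc x)) * P i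
        = real y * (exit_weight (Suc x) i * (real i - real (Suc x)) / (real i + real y) * P i)"
      by simp
  qed
  also have "\<dots> = (\<Sum>i=1..x. real y * (exit_weight (Suc x) i * (real i - real (Suc x)) / (real i + real y) * P i))"
    by simp
  also have "\<dots> = (\<Sum>i=1..x. real y * (exit_weight x i * real i / (real i + real y) * P i))"
    by (intro sum.cong refl) (simp only: exit_weight_Suc atLeastAtMost_iff)
  also have "\<dots> = real y * exit_tail m x y"
    unfolding exit_tail_def P sum_distrib_left by (intro sum.cong) auto
  finally show ?thesis by simp
qed

text \<open>The probability of reaching the next axis within \<open>N\<close> steps, at distance at most \<open>m\<close> from the origin. For large
  \<open>N\<close> it no longer depends on \<open>N\<close>, because every path ending at distance at most \<open>m\<close> is short.\<close>
primrec exit_prob :: "nat \<Rightarrow> nat \<Rightarrow> nat \<Rightarrow> nat \<Rightarrow> real" where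
  "exit_prob 0 m x y = 0"
| "exit_prob (Suc N) m x y = real x / (real x + real y) * exit_prob N m x (Suc y) +
     real y / (real x + real y) * (if x = 1 then (if y \<le> m then 1 else 0) else exit_prob N m (x - 1) y)"

lemma exit_prob_eq_0: "m < y \<Longrightarrow> exit_prob N m x y = 0"
  by (induction N arbitrary: x y) auto

text \<open>\<open>exit_prob\<close> obeys the same first-step equation and boundary values. After
  \<open>x + (Suc m - y)\<close> steps either x descents have occurred or the ascending coordinate
  has passed m, so the event is decided by then.\<close>

lemma exit_prob_eq:
  assumes "x \<ge> 1" "y \<le> Suc m" "x + (Suc m - y) \<le> N"
  shows "exit_prob N m x y = 1 - exit_tail m x y"
  using assms
proof (induction N arbitrary: x y)
  case (Suc N)
  show ?case
  proof (cases "y = Suc m")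
    case True
    then show ?thesis using Suc.prems by (simp add: exit_prob_eq_0 exit_tail_boundary del: exit_prob.simps)
  next
    case False
    then have "y \<le> m" using Suc.prems by simp
    obtain x' where x': "x = Suc x'" using Suc.prems by (cases x) auto
    have 1: "exit_prob N m x (Suc y) = 1 - exit_tail m x (Suc y)"
      using Suc.prems False by (intro Suc.IH) auto
    have 2: "(if x = 1 then (if y \<le> m then 1 else 0) else exit_prob N m (x - 1) y) = 1 - exit_tail m x' y"
      using Suc.prems \<open>y \<le> m\<close> Suc.IH[of x' y] by (auto simp: x' exit_tail_0)
    have nz: "real x + real y > 0" using Suc.prems by simp
    have "exit_prob (Suc N) m x y
      = (real x * (1 - exit_tail m x (Suc y)) + real y * (1 - exit_tail m x' y)) / (real x + real y)"
      by (simp only: exit_prob.simps 1 2) (simp add: add_divide_distrib)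
    also have "real x * (1 - exit_tail m x (Suc y)) + real y * (1 - exit_tail m x' y)
      = (real x + real y) * (1 - exit_tail m x y)"
      using exit_tail_Suc[OF \<open>y \<le> m\<close>, of x'] by (simp add: x' algebra_simps)
    finally show ?thesis using nz by simp
  qed
qed auto

section \<open>Decay and summation of the tails\<close>

lemma prod_ratio_eq:
  assumes "i \<ge> 1"
  shows "(\<Prod>j=1..m. real i / (real i + real j)) = real i ^ m * fact i / fact (i + m)"
proof (induction m)
  case (Suc m)
  have "fact (i + Suc m) = (real i + real (Suc m)) * fact (i + m)" by simp
  then show ?case using Suc assms by (simp add: divide_simps del: fact_Suc of_nat_Suc)
qed simp

text \<open>From an axis the first move is forced: the factor for \<open>j = 0\<close> is
  \<open>i / i = 1\<close>.\<close>

lemma exit_tail_from_axis: "exit_tail m x 0 = exit_tail m x 1"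
  unfolding exit_tail_def by (intro sum.cong refl) (simp add: prod.atLeast_Suc_atMost)

text \<open>Each product is eventually a constant multiple of a term of the convergent exponential
  series. The limit yields the almost sure return to the axes.\<close>

lemma exit_tail_tendsto_0: "(\<lambda>m. exit_tail m x y) \<longlonglongrightarrow> 0"
proof -
  have *: "(\<lambda>m. \<Prod>j=y..m. real i / (real i + real j)) \<longlonglongrightarrow> 0" if "i \<ge> 1" for i y
  proof -
    have pos: "real i / (real i + real j) > 0" for j using that by simp
    have "(\<lambda>m. real i ^ (m + i) /\<^sub>R fact (m + i)) \<longlonglongrightarrow> 0"
      using summable_LIMSEQ_zero[OF summable_exp_generic[of "real i"]] by (rule LIMSEQ_ignore_initial_segment)
    then have "(\<lambda>m. fact i / real i ^ i * (real i ^ (m + i) /\<^sub>R fact (m + i))) \<longlonglongrightarrow> fact i / real i ^ i * 0"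
      by (intro tendsto_intros)
    moreover have "fact i / real i ^ i * (real i ^ (m + i) /\<^sub>R fact (m + i)) = (\<Prod>j=1..m. real i / (real i + real j))" for m
      unfolding prod_ratio_eq[OF that] using that by (simp add: divide_simps power_add add.commute)
    ultimately have lim: "(\<lambda>m. \<Prod>j=1..m. real i / (real i + real j)) \<longlonglongrightarrow> 0" by simp
    \<comment> \<open>The factors below \<open>y\<close>, to be divided out of the product from 1;
      for \<open>y = 0\<close> the extra factor at \<open>j = 0\<close> is 1.\<close>
    define C where "C = (\<Prod>j=1..<y. real i / (real i + real j))"
    have "C > 0" unfolding C_def using pos by (intro prod_pos) auto
    have "(\<lambda>m. (\<Prod>j=1..m. real i / (real i + real j)) / C) \<longlonglongrightarrow> 0 / C"
      using \<open>C > 0\<close> by (intro tendsto_intros lim) auto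
    moreover have "\<forall>\<^sub>F m in sequentially. (\<Prod>j=1..m. real i / (real i + real j)) / C = (\<Prod>j=y..m. real i / (real i + real j))"
      using eventually_ge_at_top[of y]
    proof eventually_elim
      case (elim m)
      have "(\<Prod>j=1..m. real i / (real i + real j)) = C * (\<Prod>j=y..m. real i / (real i + real j))"
      proof (cases "y = 0")
        case True
        then show ?thesis using that by (simp add: C_def prod.atLeast_Suc_atMost)
      next
        case False
        have "{1..m} = {1..<y} \<union> {y..m}" using elim False by auto
        then show ?thesis unfolding C_def by (simp add: prod.union_disjoint ivl_disj_int)
      qed
      then show ?case using \<open>C > 0\<close> by simp
    qed
    ultimately show ?thesis using Lim_transform_eventually by simp
  qed
  have "(\<lambda>m. exit_tail m x y) \<longlonglongrightarrow> (\<Sum>i=1..x. exit_weight x i * 0)"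
    unfolding exit_tail_def by (intro tendsto_intros *) auto
  then show ?thesis by simp
qed

text \<open>The renewal function is the sum over all k of the probabilities that k uniform variables
  have sum at most n. The first n of these are 1, which accounts for \<open>- real n\<close>, and
  those with \<open>k = m + n\<close> are the tails.\<close>

lemma exit_tail_sums:
  assumes "n \<ge> 1"
  shows "(\<lambda>m. exit_tail m n 1) sums (renewal_coeff n - real n)"
proof -
  \<comment> \<open>\<open>\<Sum>j\<le>n. b j k\<close> is the probability that \<open>k\<close> uniform variables have sum at most \<open>n\<close>\<close>
  define b where "b j k = (if j \<le> k then (-1) ^ j * real (n - j) ^ k / (fact j * fact (k - j)) else 0)" for j k
  have b_sums: "b j sums (exp (real (n - j)) * (- real (n - j)) ^ j / fact j)" for j
  proof -
    have "(\<lambda>k. (- real (n - j)) ^ j / fact j * (real (n - j) ^ k /\<^sub>R fact k)) sums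
        ((- real (n - j)) ^ j / fact j * exp (real (n - j)))"
      by (intro sums_mult exp_converges)
    also have "(\<lambda>k. (- real (n - j)) ^ j / fact j * (real (n - j) ^ k /\<^sub>R fact k)) = (\<lambda>k. b j (k + j))"
      by (rule ext) (simp add: b_def power_minus[of "real (n - j)"] power_add divide_simps)
    \<comment> \<open>\<open>b j k\<close> is 0 for \<open>k < j\<close>, so shifting the index by
      \<open>j\<close> does not change the sum.\<close>
    finally show ?thesis
      by (subst (asm) sums_zero_iff_shift) (auto simp: b_def mult.commute)
  qed
  have "(\<lambda>k. \<Sum>j\<le>n. b j k) sums (\<Sum>j\<le>n. exp (real (n - j)) * (- real (n - j)) ^ j / fact j)"
    by (intro sums_sum b_sums)
  also have "(\<Sum>j\<le>n. exp (real (n - j)) * (- real (n - j)) ^ j / fact j) = renewal_coeff n"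
    unfolding renewal_coeff_def atMost_atLeast0 by (subst sum.atLeastAtMost_rev) simp
  finally have "(\<lambda>k. \<Sum>j\<le>n. b j k) sums renewal_coeff n" .
  then have "(\<lambda>m. \<Sum>j\<le>n. b j (m + n)) sums (renewal_coeff n - (\<Sum>k<n. \<Sum>j\<le>n. b j k))"
    by (rule sums_split_initial_segment)
  moreover have "(\<Sum>j\<le>n. b j k) = 1" if "k < n" for k
  proof -
    \<comment> \<open>The terms beyond k vanish, and the rest is a k-th difference divided by
      \<open>fact k\<close>.\<close>
    have "(\<Sum>j\<le>n. b j k) = (\<Sum>j\<le>k. b j k)"
      using that by (intro sum.mono_neutral_right) (auto simp: b_def)
    also have "\<dots> = (\<Sum>j\<le>k. (-1) ^ j * real (k choose j) * (real n - real j) ^ k / fact k)"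
      using that by (intro sum.cong) (auto simp: b_def binomial_fact of_nat_diff)
    also have "\<dots> = 1"
      unfolding sum_divide_distrib[symmetric] alternating_binomial_power_sum by simp
    finally show ?thesis .
  qed
  moreover have "(\<Sum>j\<le>n. b j (m + n)) = exit_tail m n 1" for m
  proof -
    have "(\<Sum>j\<le>n. b j (m + n)) = (\<Sum>i=0..n. b (n - i) (m + n))"
      unfolding atMost_atLeast0 by (subst sum.atLeastAtMost_rev) simp
    also have "\<dots> = b n (m + n) + (\<Sum>i=1..n. b (n - i) (m + n))"
      by (simp add: sum.atLeast_Suc_atMost)
    also have "b n (m + n) = 0" using assms by (simp add: b_def)
    also have "(\<Sum>i=1..n. b (n - i) (m + n)) = exit_tail m n 1"
      unfolding exit_tail_def
    proof (intro sum.cong refl)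
      fix i assume i: "i \<in> {1..n}"
      then have "m + n - (n - i) = i + m" by auto
      then show "b (n - i) (m + n) = exit_weight n i * (\<Prod>j=1..m. real i / (real i + real j))"
        using i unfolding prod_ratio_eq[OF conjunct1[OF iffD1[OF atLeastAtMost_iff i]]]
        by (simp add: b_def exit_weight_def power_add add.commute mult_ac trans_le_add2)
    qed
    finally show ?thesis by simp
  qed
  ultimately show ?thesis by simp
qed

section \<open>Singularity analysis\<close>

lemma renewal_denom_zero:
  assumes "renewal_denom \<rho> = 0"
  shows "\<rho> \<noteq> 0" "exp (1 - \<rho>) = inverse \<rho>"
proof -
  have "\<rho> * exp (1 - \<rho>) = 1" using assms by (simp add: renewal_denom_def)
  then show "\<rho> \<noteq> 0" "exp (1 - \<rho>) = inverse \<rho>"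
    by (auto dest: inverse_unique)
qed

lemma renewal_denom_zero_imp_char_root:
  assumes "renewal_denom \<rho> = 0" "\<rho> \<noteq> 1"
  shows "1 - \<rho> \<in> char_roots"
proof -
  have "exp (- (1 - \<rho>)) = \<rho>"
    unfolding exp_minus renewal_denom_zero(2)[OF assms(1)] by simp
  then show ?thesis using assms(2) by (simp add: char_roots_def)
qed

lemma nth_renewal_denom_expansion:
  "fps_nth (1 - (fps_const a + fps_X) * (fps_const b * fps_exp (-1))) n =
    (if n = 0 then 1 else 0) - a * b * (-1) ^ n / fact n
      - (if n = 0 then 0 else b * (-1) ^ (n - 1) / fact (n - 1))" for a b :: complex
  by (simp add: distrib_right mult.assoc)

text \<open>At a zero the derivative is \<open>1 - inverse \<rho>\<close>, which vanishes only for
  \<open>\<rho> = 1\<close>; every other pole is therefore simple.\<close>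

lemma inverse_renewal_denom_bigo_simple:
  assumes "renewal_denom \<rho> = 0" "\<rho> \<noteq> 1"
  shows "(\<lambda>z. inverse (renewal_denom z) - inverse (1 - inverse \<rho>) / (z - \<rho>)) \<in> O[at \<rho>](\<lambda>_. 1)"
proof -
  define F where "F = 1 - (fps_const \<rho> + fps_X) * (fps_const (exp (1 - \<rho>)) * fps_exp (-1))"
  have "fps_nth F 0 = 0" "fps_nth F 1 = 1 - inverse \<rho>"
    unfolding F_def nth_renewal_denom_expansion renewal_denom_zero[OF assms(1)]
    using renewal_denom_zero[OF assms(1)] by simp_all
  moreover have "1 - inverse \<rho> \<noteq> 0" using assms(2) by auto
  ultimately show ?thesis
    using inverse_simple_zero_bigo[OF renewal_denom_shift_expansion[of \<rho>, folded F_def]] by simp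
qed

text \<open>Around 1, \<open>renewal_denom (1 + t) = t^2 / 2 - t^3 / 3 + ...\<close>, whose inverse
  begins with \<open>2 / t^2 + (4/3) / t\<close>.\<close>

lemma inverse_renewal_denom_bigo_double:
  "(\<lambda>z. inverse (renewal_denom z) - 2 / (z - 1)\<^sup>2 - (4/3) / (z - 1)) \<in> O[at 1](\<lambda>_. 1)"
proof -
  define F where "F = 1 - (fps_const 1 + fps_X) * (fps_const (exp (1 - 1)) * fps_exp (-1 :: complex))"
  have F: "fps_nth F 0 = 0" "fps_nth F 1 = 0" "fps_nth F 2 = 1 / 2" "fps_nth F 3 = - (1 / 3)"
    unfolding F_def nth_renewal_denom_expansion by (simp_all add: fact_numeral)
  have "inverse (fps_nth F 2) = 2" "- fps_nth F 3 / (fps_nth F 2)\<^sup>2 = 4 / 3"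
    unfolding F by (simp_all add: power2_eq_square)
  with F show ?thesis
    using inverse_double_zero_bigo[OF renewal_denom_shift_expansion[of 1, folded F_def]]
    by (metis zero_neq_one divide_eq_0_iff zero_neq_numeral)
qed

lemma isCont_imp_bigo_1:
  fixes g :: "complex \<Rightarrow> complex"
  assumes "isCont g a"
  shows "g \<in> O[at a](\<lambda>_. 1)"
  using assms by (intro bigoI_tendsto[where c = "g a"]) (auto simp: isCont_def)

lemma geometric_expansion:
  fixes \<rho> :: complex
  shows "(\<lambda>z. inverse (1 - z * inverse \<rho>)) has_fps_expansion Abs_fps (\<lambda>n. inverse \<rho> ^ n)"
proof -
  have "(\<lambda>z. inverse (1 - z * inverse \<rho>)) has_fps_expansion inverse (1 - fps_X * fps_const (inverse \<rho>))"
    by (intro fps_expansion_intros) simp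
  moreover have "fps_nth (fps_const (inverse \<rho>) ^ i) (n - i) = (if i = n then inverse \<rho> ^ n else 0)" if "i \<le> n" for i n
    using that by (simp add: fps_const_power)
  then have "inverse (1 - fps_X * fps_const (inverse \<rho>)) = Abs_fps (\<lambda>n. inverse \<rho> ^ n)"
    by (intro fps_ext) (simp add: nth_inverse_one_minus_X_mult)
  ultimately show ?thesis by simp
qed

lemma simple_fraction_expansion:
  fixes \<rho> :: complex
  assumes "\<rho> \<noteq> 0"
  shows "(\<lambda>z. c / (z - \<rho>)) has_fps_expansion fps_const (- c * inverse \<rho>) * Abs_fps (\<lambda>n. inverse \<rho> ^ n)"
proof -
  have "c / (z - \<rho>) = (- c * inverse \<rho>) * inverse (1 - z * inverse \<rho>)" for z
    using assms by (cases "z = \<rho>") (simp_all add: field_simps)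
  then show ?thesis
    using has_fps_expansion_cmult_left[OF geometric_expansion[of \<rho>], of "- c * inverse \<rho>"] by simp
qed

lemma double_fraction_expansion:
  "(\<lambda>z::complex. c / (z - 1)\<^sup>2) has_fps_expansion fps_const c * Abs_fps (\<lambda>n. of_nat (n + 1))"
proof -
  have "c / (z - 1)\<^sup>2 = c * (inverse (1 - z * inverse 1) * inverse (1 - z * inverse 1))" for z :: complex
    by (simp add: power2_eq_square field_simps)
  moreover have "Abs_fps (\<lambda>n. inverse 1 ^ n) * Abs_fps (\<lambda>n. inverse 1 ^ n) = Abs_fps (\<lambda>n. of_nat (n + 1) :: complex)"
    by (intro fps_ext) (simp add: fps_mult_nth)
  ultimately show ?thesis
    using has_fps_expansion_cmult_left[OF has_fps_expansion_mult[OF geometric_expansion[of 1] geometric_expansion[of 1]], of c]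
    by simp
qed

text \<open>Subtracting the principal parts at all poles of modulus below \<open>R + 1\<close>
  leaves a function \<open>g\<close> holomorphic beyond the closed disc of radius R, whose Taylor
  coefficients are bounded by Cauchy's inequality. The poles other than 1 have modulus at least R
  and contribute terms of the same order.\<close>

lemma renewal_coeff_asymptotics:
  assumes R: "R > 0" and zeros: "\<And>\<rho>. renewal_denom \<rho> = 0 \<Longrightarrow> \<rho> = 1 \<or> R \<le> cmod \<rho>"
  shows "(\<lambda>n. renewal_coeff n - (2 * real n + 2 / 3)) \<in> O(\<lambda>n. (1 / R) ^ n)"
proof -
  \<comment> \<open>Larger than R, so that Cauchy's inequality applies on the circle of radius R
    even if poles lie on it, and larger than 1, so that the pole at 1 is included.\<close>
  define r where "r = R + 1"
  have hol: "renewal_denom holomorphic_on A" for A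
    unfolding renewal_denom_def by (intro holomorphic_intros)
  define P where "P = {z \<in> ball 0 r. renewal_denom z = 0}"
  have f0: "renewal_denom 0 = 1" and f1: "renewal_denom 1 = 0" by (simp_all add: renewal_denom_def)
  have "finite {z \<in> cball 0 r. renewal_denom z = 0}"
  proof (rule holomorphic_compact_finite_zeros[where S = UNIV])
    show "\<not> renewal_denom constant_on UNIV"
      using f0 f1 by (metis UNIV_I constant_on_def zero_neq_one)
  qed (use hol in auto)
  then have finP: "finite P" by (rule rev_finite_subset) (auto simp: P_def)
  define Q where "Q = P - {1}"
  have "1 \<in> P" using f1 R by (simp add: P_def r_def)
  have Q: "renewal_denom \<rho> = 0" "\<rho> \<noteq> 1" "\<rho> \<noteq> 0" "R \<le> cmod \<rho>" if "\<rho> \<in> Q" for \<rho>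
    using that zeros[of \<rho>] renewal_denom_zero[of \<rho>] by (auto simp: Q_def P_def)
  define c where "c \<rho> = inverse (1 - inverse \<rho>)" for \<rho> :: complex
  define S where "S z = (\<Sum>\<rho>\<in>Q. c \<rho> / (z - \<rho>))" for z
  define G where "G z = inverse (renewal_denom z) - 2 / (z - 1)\<^sup>2 - (4/3) / (z - 1) - S z" for z
  have "\<exists>g. g holomorphic_on ball 0 r \<and> (\<forall>z\<in>ball 0 r - P. g z = G z)"
  proof (rule removable_singularities[OF finP])
    show "P \<subseteq> interior (ball 0 r)" by (auto simp: P_def)
    show "G holomorphic_on ball 0 r - P"
      unfolding G_def S_def using \<open>1 \<in> P\<close>
      by (intro holomorphic_intros hol) (auto simp: P_def Q_def)
    fix a assume "a \<in> P"
    show "G \<in> O[at a](\<lambda>_. 1)"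
    proof (cases "a = 1")
      case True
      have "S \<in> O[at 1](\<lambda>_. 1)"
        unfolding S_def using Q by (intro isCont_imp_bigo_1 continuous_intros) auto
      then show ?thesis
        unfolding G_def True by (intro sum_in_bigo inverse_renewal_denom_bigo_double)
    next
      case False
      then have "a \<in> Q" using \<open>a \<in> P\<close> by (simp add: Q_def)
      have "(\<lambda>z. inverse (renewal_denom z) - c a / (z - a)) \<in> O[at a](\<lambda>_. 1)"
        unfolding c_def using Q[OF \<open>a \<in> Q\<close>] by (intro inverse_renewal_denom_bigo_simple)
      moreover have "(\<lambda>z. 2 / (z - 1)\<^sup>2 + (4/3) / (z - 1) + (\<Sum>\<rho>\<in>Q - {a}. c \<rho> / (z - \<rho>))) \<in> O[at a](\<lambda>_. 1)"
        using False by (intro isCont_imp_bigo_1 continuous_intros) auto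
      ultimately have "(\<lambda>z. inverse (renewal_denom z) - c a / (z - a) - (2 / (z - 1)\<^sup>2 + (4/3) / (z - 1) +
          (\<Sum>\<rho>\<in>Q - {a}. c \<rho> / (z - \<rho>)))) \<in> O[at a](\<lambda>_. 1)"
        by (rule sum_in_bigo)
      moreover have "S z = c a / (z - a) + (\<Sum>\<rho>\<in>Q - {a}. c \<rho> / (z - \<rho>))" for z
        unfolding S_def using finP \<open>a \<in> Q\<close> by (intro sum.remove) (auto simp: Q_def)
      ultimately show ?thesis
        unfolding G_def by (simp add: algebra_simps)
    qed
  qed
  then obtain g where g: "g holomorphic_on ball 0 r" "\<And>z. z \<in> ball 0 r - P \<Longrightarrow> g z = G z"
    by blast
  define K where "K = Abs_fps (\<lambda>n. of_real (renewal_coeff n)) - fps_const 2 * Abs_fps (\<lambda>n. of_nat (n + 1))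
     - fps_const (- (4/3) * inverse 1) * Abs_fps (\<lambda>n. inverse 1 ^ n)
     - (\<Sum>\<rho>\<in>Q. fps_const (- c \<rho> * inverse \<rho>) * Abs_fps (\<lambda>n. inverse \<rho> ^ n))"
  have "G has_fps_expansion K"
    unfolding G_def S_def K_def using Q
    by (intro has_fps_expansion_diff has_fps_expansion_sum renewal_denom_inverse_expansion
         double_fraction_expansion simple_fraction_expansion) auto
  moreover have "\<forall>\<^sub>F z in nhds 0. z \<in> ball 0 r - P"
    using finP f0 R by (intro eventually_nhds_in_open open_Diff finite_imp_closed) (auto simp: P_def r_def)
  then have "\<forall>\<^sub>F z in nhds 0. g z = G z"
    by eventually_elim (rule g(2))
  ultimately have "g has_fps_expansion K"
    using has_fps_expansion_cong by blast
  then have nthK: "fps_nth K n = (deriv ^^ n) g 0 / fact n" for n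
    by (rule fps_nth_fps_expansion)
  have contg: "continuous_on (cball 0 R) g"
    using g(1) by (intro holomorphic_on_imp_continuous_on holomorphic_on_subset[OF g(1)]) (auto simp: r_def)
  then have "bounded (g ` cball 0 R)"
    by (intro compact_imp_bounded compact_continuous_image) auto
  then obtain B where B: "\<And>z. z \<in> cball 0 R \<Longrightarrow> cmod (g z) \<le> B"
    unfolding bounded_iff by blast
  have K_le: "cmod (fps_nth K n) \<le> B * (1 / R) ^ n" for n
  proof -
    have "cmod ((deriv ^^ n) g 0) \<le> fact n * B / R ^ n"
      by (rule Cauchy_inequality[OF holomorphic_on_subset[OF g(1)] contg R])
        (use B in \<open>auto simp: r_def\<close>)
    then have "cmod ((deriv ^^ n) g 0) / fact n \<le> B / R ^ n"
      by (simp add: field_simps)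
    then show ?thesis by (simp add: nthK norm_divide power_divide)
  qed
  define C where "C = B + (\<Sum>\<rho>\<in>Q. cmod (c \<rho> * inverse \<rho>))"
  have "\<bar>renewal_coeff n - (2 * real n + 2 / 3)\<bar> \<le> C * (1 / R) ^ n" for n
  proof -
    \<comment> \<open>The principal part at 1 contributes
      \<open>2 * (n + 1) - 4 / 3 = 2 * n + 2 / 3\<close>.\<close>
    have "of_real (renewal_coeff n - (2 * real n + 2 / 3))
        = fps_nth K n - (\<Sum>\<rho>\<in>Q. c \<rho> * inverse \<rho> * inverse \<rho> ^ n)"
      by (simp add: K_def fps_sum_nth sum_negf algebra_simps)
    then have "\<bar>renewal_coeff n - (2 * real n + 2 / 3)\<bar>
        = cmod (fps_nth K n - (\<Sum>\<rho>\<in>Q. c \<rho> * inverse \<rho> * inverse \<rho> ^ n))"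
      by (metis norm_of_real)
    also have "\<dots> \<le> cmod (fps_nth K n) + cmod (\<Sum>\<rho>\<in>Q. c \<rho> * inverse \<rho> * inverse \<rho> ^ n)"
      by (rule norm_triangle_ineq4)
    also have "cmod (\<Sum>\<rho>\<in>Q. c \<rho> * inverse \<rho> * inverse \<rho> ^ n) \<le> (\<Sum>\<rho>\<in>Q. cmod (c \<rho> * inverse \<rho>) * (1 / R) ^ n)"
    proof (rule sum_norm_le)
      fix \<rho> assume "\<rho> \<in> Q"
      then have "inverse (cmod \<rho>) \<le> inverse R"
        using Q(4) R by (intro le_imp_inverse_le) auto
      then have "cmod (inverse \<rho>) \<le> 1 / R"
        by (simp add: norm_inverse divide_inverse)
      then show "cmod (c \<rho> * inverse \<rho> * inverse \<rho> ^ n) \<le> cmod (c \<rho> * inverse \<rho>) * (1 / R) ^ n"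
        unfolding norm_mult norm_power by (intro mult_left_mono power_mono) auto
    qed
    finally show ?thesis
      using K_le[of n] by (simp add: C_def distrib_right sum_distrib_right)
  qed
  then show ?thesis
    using R by (intro bigoI[where c = C]) (auto intro!: always_eventually)
qed

section \<open>The dominant characteristic root\<close>

text \<open>The half-plane is convex, avoids the branch cut, and on it the derivative
  \<open>inverse z\<close> is at most 1/6 in modulus. The bound 6 lies just below
  \<open>2 * pi\<close>.\<close>

lemma Ln_lipschitz:
  assumes "Im w \<le> -6" "Im v \<le> -6"
  shows "cmod (Ln w - Ln v) \<le> cmod (w - v) / 6"
proof -
  define S where "S = {z. Im z \<le> -6}"
  have "norm (Ln w - Ln v) \<le> (1/6) * norm (w - v)"
  proof (rule field_differentiable_bound[where S = S and f' = inverse])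
    show "convex S"
      unfolding S_def by (rule convex_halfspace_Im_le)
    fix z assume "z \<in> S"
    then have "Im z \<le> -6" by (simp add: S_def)
    then have "z \<notin> \<real>\<^sub>\<le>\<^sub>0"
      by (auto simp: complex_nonpos_Reals_iff)
    then show "(Ln has_field_derivative inverse z) (at z within S)"
      by (simp add: has_field_derivative_Ln has_field_derivative_at_within)
    have "cmod z \<ge> 6"
      using abs_Im_le_cmod[of z] \<open>Im z \<le> -6\<close> by linarith
    then have "inverse (cmod z) \<le> inverse 6" by (intro le_imp_inverse_le) auto
    then show "norm (inverse z) \<le> 1/6" by (simp add: norm_inverse)
  qed (use assms in \<open>auto simp: S_def\<close>)
  then show ?thesis by simp
qed

text \<open>A region mapped into itself by \<open>log_map\<close> that isolates the root with the
  smallest positive imaginary part.\<close>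

definition root_strip :: "complex set" where
  "root_strip = {l. Re l \<le> 0 \<and> 2 * pi \<le> Im l \<and> Im l \<le> 5 * pi / 2}"

text \<open>The branch of the logarithm for which \<open>1 - l = exp (- l)\<close> becomes a fixed point equation with its
  solution in the strip; there it contracts by the factor \<open>1 / (2 * pi)\<close>.\<close>
definition log_map :: "complex \<Rightarrow> complex" where
  "log_map l = 2 * of_real pi * \<i> - Ln (1 - l)"

lemma log_map_lipschitz:
  assumes "2 * pi \<le> Im x" "2 * pi \<le> Im y"
  shows "cmod (log_map x - log_map y) \<le> cmod (x - y) / 6"
proof -
  have "cmod (Ln (1 - y) - Ln (1 - x)) \<le> cmod ((1 - y) - (1 - x)) / 6"
    using assms pi_gt3 by (intro Ln_lipschitz) auto
  then show ?thesis by (simp add: log_map_def)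
qed

lemma exp_eq_if_log_map_fixed:
  assumes "log_map l = l" "l \<noteq> 1"
  shows "exp (- l) = 1 - l"
proof -
  have "exp (- l) = exp (Ln (1 - l) - 2 * of_real pi * \<i>)"
    using assms(1) by (metis log_map_def minus_diff_eq)
  also have "\<dots> = 1 - l"
    using assms(2) by (simp add: exp_diff exp_two_pi_i)
  finally show ?thesis .
qed

text \<open>\<open>1 - l\<close> lies in the open fourth quadrant and outside the open unit disc, so
  its logarithm has nonnegative real part and imaginary part between \<open>- pi / 2\<close> and
  0.\<close>

lemma log_map_strip:
  assumes "l \<in> root_strip"
  shows "log_map l \<in> root_strip"
proof -
  have l: "Re l \<le> 0" "2 * pi \<le> Im l" using assms by (auto simp: root_strip_def)
  then have n: "Re (1 - l) > 0" "Im (1 - l) < 0" "1 - l \<noteq> 0"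
    using pi_gt_zero by (auto simp: complex_eq_iff simp del: pi_gt_zero)
  have "1 \<le> cmod (1 - l)"
    using abs_Re_le_cmod[of "1 - l"] l by simp
  moreover have "\<bar>Im (Ln (1 - l))\<bar> < pi/2"
    using n Re_Ln_pos_lt[of "1 - l"] by simp
  moreover have "Im (Ln (1 - l)) < 0"
    using n Im_Ln_pos_le[of "1-l"] \<open>\<bar>Im (Ln (1 - l))\<bar> < pi/2\<close> pi_gt_zero by argo
  ultimately show ?thesis
    using n by (auto simp: root_strip_def log_map_def Re_Ln)
qed

lemma ex1_log_map_fixed: "\<exists>!l. l \<in> root_strip \<and> log_map l = l"
proof (rule Banach_fix[of _ "1/6"])
  have "root_strip = {l. Re l \<le> 0} \<inter> ({l. 2 * pi \<le> Im l} \<inter> {l. Im l \<le> 5 * pi / 2})"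
    by (auto simp: root_strip_def)
  moreover have "closed \<dots>"
    by (intro closed_Int closed_halfspace_Re_le closed_halfspace_Im_ge closed_halfspace_Im_le)
  ultimately show "Topological_Spaces.complete root_strip" by (simp add: complete_eq_closed)
  show "root_strip \<noteq> {}"
    by (auto simp: root_strip_def intro!: exI[of _ "Complex 0 (2*pi)"])
  show "log_map ` root_strip \<subseteq> root_strip" using log_map_strip by auto
  fix x y assume "x \<in> root_strip" "y \<in> root_strip"
  then show "dist (log_map x) (log_map y) \<le> 1 / 6 * dist x y"
    using log_map_lipschitz[of x y] by (simp add: dist_norm root_strip_def)
qed simp_all

section \<open>Real and imaginary parts of the roots\<close>

lemma char_root_equations:
  assumes "l \<in> char_roots"
  shows "1 - Re l = exp (- Re l) * cos (Im l)" "Im l = exp (- Re l) * sin (Im l)"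
proof -
  have "exp (- l) = 1 - l" using assms by (simp add: char_roots_def algebra_simps eq_neg_iff_add_eq_0)
  then have "Re (exp (-l)) = Re (1 - l)" "Im (exp (-l)) = Im (1 - l)" by auto
  then show "1 - Re l = exp (- Re l) * cos (Im l)" "Im l = exp (- Re l) * sin (Im l)"
    by (auto simp: Re_exp Im_exp)
qed

lemma char_root_Im_nonzero:
  assumes "l \<in> char_roots"
  shows "Im l \<noteq> 0"
proof
  assume "Im l = 0"
  then have "1 - Re l = exp (- Re l)" using char_root_equations(1)[OF assms] by simp
  moreover have "exp (- Re l) > 1 + (- Re l)" if "Re l \<noteq> 0"
    using exp_minus_greater[of "Re l"] that by simp
  ultimately have "Re l = 0" by force
  with \<open>Im l = 0\<close> have "l = 0" by (simp add: complex_eq_iff)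
  with assms show False by (simp add: char_roots_def)
qed

text \<open>The bound \<open>\<bar>sin t\<bar> \<le> \<bar>t\<bar>\<close> in the imaginary equation
  gives \<open>exp (- Re l) \<ge> 1\<close>; for \<open>Re l = 0\<close> the two equations would
  force \<open>Im l = 0\<close>.\<close>

lemma char_root_Re_neg:
  assumes "l \<in> char_roots"
  shows "Re l < 0"
proof -
  have "\<bar>Im l\<bar> = exp (- Re l) * \<bar>sin (Im l)\<bar>"
    using char_root_equations(2)[OF assms] by (metis abs_exp_cancel abs_mult)
  also have "\<dots> \<le> exp (- Re l) * \<bar>Im l\<bar>"
    using abs_sin_x_le_abs_x[of "Im l"] by simp
  finally have "1 \<le> exp (- Re l)"
    using char_root_Im_nonzero[OF assms] by simp
  moreover have "Re l \<noteq> 0"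
  proof
    assume "Re l = 0"
    then have "cos (Im l) = 1" "sin (Im l) = Im l"
      using char_root_equations[OF assms] by auto
    then show False
      using char_root_Im_nonzero[OF assms] sin_cos_squared_add[of "Im l"] by simp
  qed
  ultimately show ?thesis by simp
qed

lemma char_root_Im_squared:
  assumes "l \<in> char_roots"
  shows "(Im l)\<^sup>2 = exp (- 2 * Re l) - (1 - Re l)\<^sup>2"
proof -
  have "(1 - Re l)\<^sup>2 + (Im l)\<^sup>2 = (exp (- Re l))\<^sup>2 * ((cos (Im l))\<^sup>2 + (sin (Im l))\<^sup>2)"
    using char_root_equations[OF assms] by (metis distrib_left power_mult_distrib)
  also have "\<dots> = exp (- 2 * Re l)" by (simp add: exp_double[symmetric])
  finally show ?thesis by simp
qed

text \<open>Taking squared moduli in \<open>1 - l = exp (- l)\<close> makes \<open>(Im l)\<^sup>2\<close> a strictly increasing function of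
  \<open>- Re l\<close>, so the roots are ordered by their imaginary parts.\<close>
lemma exp_double_minus_square_strict_mono:
  fixes s t :: real
  assumes "0 \<le> s" "s < t"
  shows "exp (2 * s) - (1 + s)\<^sup>2 < exp (2 * t) - (1 + t)\<^sup>2"
proof (rule DERIV_pos_imp_increasing_open[OF assms(2)])
  fix x assume "s < x" "x < t"
  have "((\<lambda>x. exp (2 * x) - (1 + x)\<^sup>2) has_real_derivative (2 * exp (2 * x) - 2 * (1 + x))) (at x)"
    by (auto intro!: derivative_eq_intros)
  moreover have "2 * exp (2 * x) - 2 * (1 + x) > 0"
    using exp_ge_add_one_self[of "2*x"] \<open>s < x\<close> assms(1) by argo
  ultimately show "\<exists>y. ((\<lambda>x. exp (2 * x) - (1 + x)\<^sup>2) has_real_derivative y) (at x) \<and> 0 < y"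
    by blast
qed (auto intro!: continuous_intros)

lemma char_root_Re_le:
  assumes "l \<in> char_roots" "m \<in> char_roots" "\<bar>Im l\<bar> \<le> \<bar>Im m\<bar>"
  shows "Re m \<le> Re l"
proof (rule ccontr)
  assume "\<not> Re m \<le> Re l"
  then have "exp (2 * (- Re m)) - (1 + (- Re m))\<^sup>2 < exp (2 * (- Re l)) - (1 + (- Re l))\<^sup>2"
    using char_root_Re_neg[OF assms(2)] by (intro exp_double_minus_square_strict_mono) auto
  then have "(Im m)\<^sup>2 < (Im l)\<^sup>2"
    using char_root_Im_squared assms(1,2) by simp
  with assms(3) show False by (simp add: abs_le_square_iff)
qed

lemma mult_cos_less_sin:
  fixes x :: real
  assumes "0 < x" "x < pi"
  shows "x * cos x < sin x"
proof -
  have "(\<lambda>t. sin t - t * cos t) 0 < (\<lambda>t. sin t - t * cos t) x"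
  proof (rule DERIV_pos_imp_increasing_open[OF assms(1)])
    fix t assume t: "0 < t" "t < x"
    have "((\<lambda>t. sin t - t * cos t) has_real_derivative t * sin t) (at t)"
      by (auto intro!: derivative_eq_intros)
    moreover have "t * sin t > 0" using t assms sin_gt_zero[of t] by simp
    ultimately show "\<exists>y. ((\<lambda>t. sin t - t * cos t) has_real_derivative y) (at t) \<and> 0 < y"
      by blast
  qed (auto intro!: continuous_intros)
  then show ?thesis by simp
qed

text \<open>Sine and cosine of \<open>Im l\<close> are positive by the two equations, which excludes
  \<open>[pi, 2 * pi]\<close>. Below pi, \<open>mult_cos_less_sin\<close> would give
  \<open>Im l * (1 - Re l) < Im l\<close>, contrary to \<open>Re l < 0\<close>.\<close>

lemma char_root_Im_gt_two_pi:
  assumes "l \<in> char_roots" "Im l > 0"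
  shows "Im l > 2 * pi"
proof (rule ccontr)
  assume "\<not> Im l > 2 * pi"
  moreover have "sin (Im l) > 0" "cos (Im l) > 0"
    using char_root_equations[OF assms(1)] assms(2) char_root_Re_neg[OF assms(1)]
    by (smt (verit) exp_gt_zero mult_nonneg_nonpos)+
  ultimately have "Im l < pi"
    using sin_le_zero[of "Im l"] by (cases "Im l = 2 * pi") force+
  then have "Im l * cos (Im l) < sin (Im l)"
    using assms(2) by (intro mult_cos_less_sin)
  then have "exp (- Re l) * (Im l * cos (Im l)) < exp (- Re l) * sin (Im l)" by simp
  then have "Im l * (1 - Re l) < Im l"
    using char_root_equations[OF assms(1)] by (metis mult.left_commute)
  then show False
    using char_root_Re_neg[OF assms(1)] assms(2) by (simp add: algebra_simps zero_less_mult_iff)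
qed

lemma char_root_in_strip:
  assumes "l \<in> char_roots" "Im l > 0" "Im l \<le> 5 * pi / 2"
  shows "l \<in> root_strip" "log_map l = l"
proof -
  have gt: "Im l > 2 * pi" using assms char_root_Im_gt_two_pi by blast
  then show "l \<in> root_strip"
    using assms char_root_Re_neg[OF assms(1)] by (auto simp: root_strip_def)
  have "exp (2 * of_real pi * \<i> - l) = 1 - l"
    using assms(1) by (simp add: char_roots_def exp_diff exp_minus field_simps exp_two_pi_i)
  \<comment> \<open>\<open>2 * pi - Im l\<close> lies in \<open>[- pi / 2, 0)\<close>, within the
    range of the principal logarithm.\<close>
  moreover have "Ln (exp (2 * of_real pi * \<i> - l)) = 2 * of_real pi * \<i> - l"
    using gt assms(3) pi_gt_zero by (intro Ln_exp) auto
  ultimately show "log_map l = l" by (simp add: log_map_def)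
qed

section \<open>Numerical location of the root\<close>

lemma horner_step:
  fixes e :: real and w h :: complex and k :: real
  assumes "cmod (h - Complex a b) \<le> e" "cmod w \<le> 1/2" "k \<ge> 1"
    and "\<bar>1 + (Re w * a - Im w * b) / k - a'\<bar> \<le> e / 4"
    and "\<bar>(Re w * b + Im w * a) / k - b'\<bar> \<le> e / 4"
  shows "cmod (1 + w / of_real k * h - Complex a' b') \<le> e"
proof -
  \<comment> \<open>\<open>r\<close> is the rounding error, at most \<open>e / 2\<close>. The
    inherited error is at least halved by \<open>cmod w \<le> 1/2\<close>, so the same
    \<open>e\<close> serves at every step.\<close>
  define r where "r = 1 + w / of_real k * Complex a b - Complex a' b'"
  have "cmod r \<le> \<bar>Re r\<bar> + \<bar>Im r\<bar>" by (rule cmod_le)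
  moreover have "Re r = 1 + (Re w * a - Im w * b) / k - a'" "Im r = (Re w * b + Im w * a) / k - b'"
    by (simp_all add: r_def Re_divide_of_real Im_divide_of_real add_divide_distrib diff_divide_distrib)
  ultimately have "cmod r \<le> e / 2" using assms(4,5) by linarith
  moreover have "cmod (w / of_real k) \<le> 1/2 / 1"
    unfolding norm_divide norm_of_real using assms(2,3) by (intro frac_le) auto
  then have "cmod (w / of_real k * (h - Complex a b)) \<le> 1/2 * e"
    unfolding norm_mult using assms(1) by (intro mult_mono) auto
  ultimately have "cmod (w / of_real k * (h - Complex a b) + r) \<le> e"
    using norm_triangle_ineq[of "w / of_real k * (h - Complex a b)" r] by linarith
  then show ?thesis by (simp add: r_def algebra_simps)
qed

text \<open>Error propagation through \<open>u^2 - v^2 = (u - v) * (u + v)\<close>, with B bounding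
  the modulus of the rounded value \<open>v\<close> and d the rounding in each coordinate.\<close>

lemma square_step:
  fixes e :: real
  assumes "cmod (u - Complex a b) \<le> e" "\<bar>a\<bar> + \<bar>b\<bar> \<le> B"
    and "\<bar>a * a - b * b - a'\<bar> \<le> d" "\<bar>2 * a * b - b'\<bar> \<le> d" "e * (2 * B + e) + 2 * d \<le> e'"
  shows "cmod (u ^ 2 - Complex a' b') \<le> e'"
proof -
  define v where "v = Complex a b"
  define r where "r = v * v - Complex a' b'"
  have "cmod r \<le> \<bar>Re r\<bar> + \<bar>Im r\<bar>" by (rule cmod_le)
  then have r: "cmod r \<le> 2 * d" using assms(3,4) by (simp add: r_def v_def algebra_simps)
  have "cmod v \<le> B" using cmod_le[of v] assms(2) by (simp add: v_def)
  moreover have uv: "cmod (u - v) \<le> e" using assms(1) by (simp add: v_def)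
  moreover have "cmod (u + v) \<le> cmod (2 * v) + cmod (u - v)"
    using norm_triangle_ineq[of "2 * v" "u - v"] by (simp add: algebra_simps)
  ultimately have "cmod (u + v) \<le> 2 * B + e" by (simp add: norm_mult)
  then have "cmod ((u - v) * (u + v)) \<le> e * (2 * B + e)"
    unfolding norm_mult using uv by (intro mult_mono) (auto intro: order_trans[OF norm_ge_zero])
  moreover have "u ^ 2 - Complex a' b' = (u - v) * (u + v) + r"
    by (simp add: r_def algebra_simps power2_eq_square)
  ultimately show ?thesis
    using norm_triangle_ineq[of "(u - v) * (u + v)" r] r assms(5) by simp
qed

text \<open>This bounds the residual \<open>exp (- c) - (1 - c)\<close> of the decimal approximation
  \<open>c\<close> to the root.\<close>

lemma exp_approx_root:
  "cmod (exp (Complex 2.088843016 (-7.4614892864)) - Complex 3.088843016 (-7.4614892864)) \<le> 3 / 10 ^ 8"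
proof -
  \<comment> \<open>one sixteenth of the exponent: the Taylor polynomial of degree 11 by Horner's scheme, then four squarings\<close>
  define w where "w = Complex 0.1305526885 (-0.4663430804)"
  have w: "cmod w \<le> 1/2"
    by (rule power2_le_imp_le) (simp_all add: w_def cmod_power2, simp add: power2_eq_square)
  let ?h11 = "1 + w / 11 * 1"
  have step11: "cmod (?h11 - Complex 1.011868426227 (-0.042394825491)) \<le> 4 / 10 ^ 12"
    using horner_step[of 1 1 0 "4 / 10 ^ 12" w 11 "1.011868426227" "-0.042394825491"] w
    by (simp add: w_def flip: one_complex.code)
  let ?h10 = "1 + w / 10 * ?h11"
  have step10: "cmod (?h10 - Complex 1.011233160994 (-0.047741259729)) \<le> 4 / 10 ^ 12"
    using horner_step[OF step11 w, of 10 "1.011233160994" "-0.047741259729"] by (simp add: w_def)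
  let ?h9 = "1 + w / 9 * ?h10"
  have step9: "cmod (?h9 - Complex 1.012195044638 (-0.053090481901)) \<le> 4 / 10 ^ 12"
    using horner_step[OF step10 w, of 9 "1.012195044638" "-0.053090481901"] by (simp add: w_def)
  let ?h8 = "1 + w / 8 * ?h9"
  have step8: "cmod (?h8 - Complex 1.013423300687 (-0.059870157529)) \<le> 4 / 10 ^ 12"
    using horner_step[OF step9 w, of 8 "1.013423300687" "-0.059870157529"] by (simp add: w_def)
  let ?h7 = "1 + w / 7 * ?h8"
  have step7: "cmod (?h7 - Complex 1.014912157544 (-0.068631307688)) \<le> 4 / 10 ^ 12"
    using horner_step[OF step8 w, of 7 "1.014912157544" "-0.068631307688"] by (simp add: w_def)
  let ?h6 = "1 + w / 6 * ?h7"
  have step6: "cmod (?h6 - Complex 1.016748962553 (-0.080376210603)) \<le> 4 / 10 ^ 12"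
    using horner_step[OF step7 w, of 6 "1.016748962553" "-0.080376210603"] by (simp add: w_def)
  let ?h5 = "1 + w / 5 * ?h6"
  have step5: "cmod (?h5 - Complex 1.019051284189 (-0.096929434715)) \<le> 4 / 10 ^ 12"
    using horner_step[OF step6 w, of 5 "1.019051284189" "-0.096929434715"] by (simp add: w_def)
  let ?h4 = "1 + w / 4 * ?h5"
  have step4: "cmod (?h4 - Complex 1.021959378426 (-0.121970478313)) \<le> 4 / 10 ^ 12"
    using horner_step[OF step5 w, of 4 "1.021959378426" "-0.121970478313"] by (simp add: w_def)
  let ?h3 = "1 + w / 3 * ?h4"
  have step3: "cmod (?h3 - Complex 1.025513151939 (-0.164169086147)) \<le> 4 / 10 ^ 12"
    using horner_step[OF step4 w, of 3 "1.025513151939" "-0.164169086147"] by (simp add: w_def)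
  let ?h2 = "1 + w / 2 * ?h3"
  have step2: "cmod (?h2 - Complex 1.028662190869 (-0.249836838916)) \<le> 4 / 10 ^ 12"
    using horner_step[OF step3 w, of 2 "1.028662190869" "-0.249836838916"] by (simp add: w_def)
  let ?h1 = "1 + w / 1 * ?h2"
  have step1: "cmod (?h1 - Complex 1.017784933519 (-0.512326365788)) \<le> 4 / 10 ^ 12"
    using horner_step[OF step2 w, of 1 "1.017784933519" "-0.512326365788"] by (simp add: w_def)
  have "cmod (exp w - (\<Sum>i\<le>11. w ^ i / fact i)) \<le> exp (cmod w) * cmod w ^ Suc 11 / fact 11"
    by (rule Taylor_exp_field)
  moreover have "exp (cmod w) * cmod w ^ Suc 11 / fact 11 \<le> 3 * (1/2) ^ Suc 11 / fact 11"
    using w exp_le order_trans[of "exp (cmod w)" "exp 1" 3]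
    by (intro divide_right_mono mult_mono power_mono) auto
  moreover have "3 * (1/2) ^ Suc 11 / (fact 11 :: real) \<le> 2 / 10 ^ 11"
    by (simp add: fact_numeral power_divide)
  ultimately have "cmod (exp w - (\<Sum>i\<le>11. w ^ i / fact i)) \<le> 2 / 10 ^ 11" by linarith
  moreover have "(\<Sum>i\<le>11. w ^ i / fact i) = ?h1"
    by (simp add: atMost_nat_numeral fact_numeral field_simps numeral_eq_Suc)
  ultimately have "cmod (exp w - ?h1) \<le> 2 / 10 ^ 11" by (simp only:)
  then have "cmod (exp w - Complex 1.017784933519 (-0.512326365788)) \<le> 3 / 10 ^ 11"
    using step1 norm_triangle_ineq[of "exp w - ?h1" "?h1 - Complex 1.017784933519 (-0.512326365788)"]
    by simp
  \<comment> \<open>Each squaring multiplies the error by about \<open>2 * B\<close>, where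
    \<open>B\<close> bounds the sum of the moduli of the coordinates.\<close>
  then have "cmod ((exp w)\<^sup>2 - Complex 0.773407865817 (-1.042876112287)) \<le> 11 / 10 ^ 11"
    by (rule square_step[where B = "1.6" and d = "1 / 10 ^ 12"]) simp_all
  then have "cmod (((exp w)\<^sup>2)\<^sup>2 - Complex (-0.489430858671) (-1.613137176631)) \<le> 43 / 10 ^ 11"
    by (rule square_step[where B = "1.9" and d = "1 / 10 ^ 12"]) simp_all
  then have "cmod ((((exp w)\<^sup>2)\<^sup>2)\<^sup>2 - Complex (-2.362668985210) (1.579038227025)) \<le> 190 / 10 ^ 11"
    by (rule square_step[where B = "2.2" and d = "1 / 10 ^ 12"]) simp_all
  then have "cmod (((((exp w)\<^sup>2)\<^sup>2)\<^sup>2)\<^sup>2 - Complex 3.088843011267 (-7.461489290906)) \<le> 1521 / 10 ^ 11"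
    by (rule square_step[where B = "4.0" and d = "1 / 10 ^ 12"]) simp_all
  moreover have "((((exp w)\<^sup>2)\<^sup>2)\<^sup>2)\<^sup>2 = exp (Complex 2.088843016 (-7.4614892864))"
  proof -
    have "((((exp w)\<^sup>2)\<^sup>2)\<^sup>2)\<^sup>2 = exp (of_nat 16 * w)"
      unfolding exp_of_nat_mult by (simp flip: power_mult)
    also have "of_nat 16 * w = Complex 2.088843016 (-7.4614892864)"
      by (simp add: w_def complex_eq_iff)
    finally show ?thesis .
  qed
  moreover have "cmod (Complex 3.088843011267 (-7.461489290906) - Complex 3.088843016 (-7.4614892864)) \<le> 1 / 10 ^ 8"
    by (rule order_trans[OF cmod_le]) simp
  ultimately show ?thesis
    using norm_triangle_ineq[of "exp (Complex 2.088843016 (-7.4614892864)) - Complex 3.088843011267 (-7.461489290906)"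
      "Complex 3.088843011267 (-7.461489290906) - Complex 3.088843016 (-7.4614892864)"]
    by simp
qed

text \<open>The root in the strip has the smallest positive imaginary part, hence by
  \<open>char_root_Re_le\<close> and conjugation the largest real part. Its digits follow from an a
  posteriori estimate for the contraction at an approximate fixed point.\<close>

lemma dominant_char_root:
  obtains \<alpha> \<beta> where "Complex \<alpha> \<beta> \<in> char_roots" "\<forall>l\<in>char_roots. Re l \<le> \<alpha>"
    "2.088843 \<le> - \<alpha>" "- \<alpha> < 2.088844" "7.461489 \<le> \<beta>" "\<beta> < 7.461490"
proof -
  obtain l where l: "l \<in> root_strip" "log_map l = l"
    and unique: "\<And>l'. l' \<in> root_strip \<Longrightarrow> log_map l' = l' \<Longrightarrow> l' = l"
    using ex1_log_map_fixed by blast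
  have Im: "2 * pi \<le> Im l" "Im l \<le> 5 * pi / 2" using l by (auto simp: root_strip_def)
  have Im_pos: "Im l > 0" using Im(1) pi_gt_zero by linarith
  have "l \<noteq> 0" "l \<noteq> 1" using Im_pos by auto
  then have root: "l \<in> char_roots"
    using exp_eq_if_log_map_fixed[OF l(2)] by (simp add: char_roots_def)
  define c where "c = Complex (-2.088843016) 7.4614892864"
  have pi: "3 < pi" "pi < 3.2" using pi_approx by auto
  \<comment> \<open>\<open>c\<close> misses being a fixed point by a difference of two logarithms
    whose arguments differ by the residual.\<close>
  have "log_map c - c = Ln (exp (- c)) - Ln (1 - c)"
  proof -
    have "exp (2 * of_real pi * \<i> - c) = exp (- c)"
      by (simp add: exp_diff exp_minus field_simps)
    moreover have "Ln (exp (2 * of_real pi * \<i> - c)) = 2 * of_real pi * \<i> - c"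
      using pi by (intro Ln_exp) (auto simp: c_def)
    ultimately show ?thesis by (simp add: log_map_def)
  qed
  moreover have approx: "cmod (exp (- c) - (1 - c)) \<le> 3 / 10 ^ 8"
    using exp_approx_root by (simp add: c_def complex_minus complex_diff one_complex.code)
  moreover have "Im (exp (- c)) \<le> -6"
    using approx abs_Im_le_cmod[of "exp (- c) - (1 - c)"] by (simp add: c_def)
  then have "cmod (Ln (exp (- c)) - Ln (1 - c)) \<le> cmod (exp (- c) - (1 - c)) / 6"
    by (intro Ln_lipschitz) (auto simp: c_def)
  ultimately have "cmod (log_map c - c) \<le> 3 / 10 ^ 8 / 6" by simp
  moreover have "cmod (log_map l - log_map c) \<le> cmod (l - c) / 6"
    using Im pi by (intro log_map_lipschitz) (auto simp: c_def)
  \<comment> \<open>With contraction factor 1/6 the distance is at most 6/5 of the defect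
    \<open>5 / 10 ^ 9\<close>.\<close>
  moreover have "cmod (l - c) \<le> cmod (log_map l - log_map c) + cmod (log_map c - c)"
    using norm_triangle_ineq[of "log_map l - log_map c" "log_map c - c"] l(2) by simp
  ultimately have "cmod (l - c) \<le> 6 / 10 ^ 9" by simp
  then have "\<bar>Re (l - c)\<bar> \<le> 6 / 10 ^ 9" "\<bar>Im (l - c)\<bar> \<le> 6 / 10 ^ 9"
    using abs_Re_le_cmod[of "l - c"] abs_Im_le_cmod[of "l - c"] by linarith+
  then have bounds: "2.088843 \<le> - Re l" "- Re l < 2.088844" "7.461489 \<le> Im l" "Im l < 7.461490"
    unfolding abs_le_iff c_def minus_complex.sel complex.sel by simp_all
  have max: "Re m \<le> Re l" if m: "m \<in> char_roots" for m
  proof -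
    have pos: "Re m' \<le> Re l" if "m' \<in> char_roots" "Im m' > 0" for m'
    proof (cases "Im m' \<le> 5 * pi / 2")
      case True
      then show ?thesis using unique char_root_in_strip that by blast
    next
      case False
      then show ?thesis using char_root_Re_le[OF root that(1)] Im Im_pos by simp
    qed
    have "cnj m - 1 + exp (- cnj m) = cnj (m - 1 + exp (- m))"
      by (simp add: exp_cnj)
    also have "m - 1 + exp (- m) = 0"
      using m by (simp add: char_roots_def)
    finally have "cnj m \<in> char_roots"
      using m by (simp add: char_roots_def del: exp_cnj)
    then show ?thesis
      using pos[OF m] pos[of "cnj m"] char_root_Im_nonzero[OF m] by (cases "Im m > 0") auto
  qed
  show ?thesis
    using that[of "Re l" "Im l"] root max bounds by simp
qed

section \<open>The urn process\<close>

text \<open>In the coordinates \<open>(descent, ascent)\<close> the urn has the same law in all four quadrants: the descent coordinate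
  falls to zero, at which moment the ascent coordinate is the new value of the embedded chain.\<close>
definition descent :: "int \<times> int \<Rightarrow> nat" where
  "descent s = (case s of (x, y) \<Rightarrow>
     if x * y > 0 then nat \<bar>x\<bar> else if x * y < 0 then nat \<bar>y\<bar> else nat (\<bar>x\<bar> + \<bar>y\<bar>))"

definition ascent :: "int \<times> int \<Rightarrow> nat" where
  "ascent s = (case s of (x, y) \<Rightarrow>
     if x * y > 0 then nat \<bar>y\<bar> else if x * y < 0 then nat \<bar>x\<bar> else 0)"

definition on_axis :: "int \<times> int \<Rightarrow> bool" where
  "on_axis s \<longleftrightarrow> fst s * snd s = 0"

definition level :: "int \<times> int \<Rightarrow> nat" where
  "level s = nat (\<bar>fst s\<bar> + \<bar>snd s\<bar>)"

text \<open>The four quadrants and the two axes are six sign cases of one transition rule. On an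
  axis \<open>down\<close> is a placeholder of probability 0, hence the premise
  \<open>ascent s > 0\<close> in its properties.\<close>

lemma urn_kernel_step:
  assumes "s \<noteq> (0, 0)"
  obtains up down where "up \<noteq> down"
    "urn_kernel s up = real (descent s) / (real (descent s) + real (ascent s))"
    "urn_kernel s down = real (ascent s) / (real (descent s) + real (ascent s))"
    "\<not> on_axis up" "descent up = descent s" "ascent up = Suc (ascent s)"
    "ascent s > 0 \<longrightarrow> (on_axis down \<longleftrightarrow> descent s = 1)"
    "ascent s > 0 \<and> descent s = 1 \<longrightarrow> level down = ascent s"
    "ascent s > 0 \<and> descent s \<noteq> 1 \<longrightarrow> descent down = descent s - 1 \<and> ascent down = ascent s"
proof -
  obtain x y where s: "s = (x, y)" by (cases s)
  note defs = s urn_kernel_def descent_def ascent_def on_axis_def level_def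
    zero_less_mult_iff mult_less_0_iff nat_add_distrib
  consider "x > 0" "y > 0" | "x < 0" "y < 0" | "x \<noteq> 0" "y = 0"
    | "x < 0" "y > 0" | "x > 0" "y < 0" | "x = 0" "y \<noteq> 0"
    using assms s by fastforce
  then show thesis
  proof cases
    case 1
    then show ?thesis
      by (intro that[of "(x, y + 1)" "(x - 1, y)"]) (simp_all add: defs, auto?)
  next
    case 2
    then show ?thesis
      by (intro that[of "(x, y - 1)" "(x + 1, y)"]) (simp_all add: defs, auto?)
  next
    case 3
    then show ?thesis
      by (intro that[of "(x, sgn x)" "(x, 0)"]) (auto simp: defs sgn_if)
  next
    case 4
    then show ?thesis
      by (intro that[of "(x - 1, y)" "(x, y - 1)"]) (simp_all add: defs, auto?)
  next
    case 5
    then show ?thesis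
      by (intro that[of "(x + 1, y)" "(x, y + 1)"]) (simp_all add: defs, auto?)
  next
    case 6
    then show ?thesis
      by (intro that[of "(- sgn y, y)" "(0, y)"]) (auto simp: defs sgn_if)
  qed
qed

lemma descent_pos: "s \<noteq> (0, 0) \<Longrightarrow> descent s > 0"
  by (auto simp: descent_def split: prod.split)

lemma descent_on_axis: "on_axis s \<Longrightarrow> descent s = level s"
  and ascent_on_axis: "on_axis s \<Longrightarrow> ascent s = 0"
  by (auto simp: descent_def ascent_def on_axis_def level_def split: prod.split)

lemma urn_kernel_pos_imp_nonzero:
  assumes "urn_kernel s t > 0"
  shows "t \<noteq> (0, 0)"
  using assms by (auto simp: urn_kernel_def split: prod.splits if_splits)

section \<open>Path probabilities and first-step analysis\<close>

context simple_harmonic_urn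
begin

definition state :: "nat \<Rightarrow> 'a \<Rightarrow> int \<times> int" where
  "state n \<omega> = (X n \<omega>, Y n \<omega>)"

lemma measurable_state [measurable]: "state n \<in> M \<rightarrow>\<^sub>M count_space UNIV"
proof -
  have [measurable]: "X n \<in> M \<rightarrow>\<^sub>M count_space UNIV" "Y n \<in> M \<rightarrow>\<^sub>M count_space UNIV"
    by (rule X_measurable Y_measurable)+
  have "(\<lambda>\<omega>. (X n \<omega>, Y n \<omega>)) \<in> M \<rightarrow>\<^sub>M count_space UNIV \<Otimes>\<^sub>M count_space UNIV"
    by measurable
  then show ?thesis
    unfolding state_def by (simp add: pair_measure_countable)
qed

definition path_event :: "nat \<Rightarrow> (nat \<Rightarrow> int \<times> int) \<Rightarrow> 'a set" where
  "path_event t s = {\<omega> \<in> space M. \<forall>i\<le>t. state i \<omega> = s i}"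

lemma path_event_sets [measurable]: "path_event t s \<in> sets M"
  unfolding path_event_def by measurable

text \<open>The product form of \<open>markov\<close>, which covers histories of positive
  probability; for the others both sides are 0.\<close>

lemma prob_path_event_Suc:
  "prob (path_event (Suc t) s) = prob (path_event t s) * urn_kernel (s t) (s (Suc t))"
proof (cases "prob (path_event t s) = 0")
  case True
  have "prob (path_event (Suc t) s) \<le> prob (path_event t s)"
    by (intro finite_measure_mono) (auto simp: path_event_def)
  then show ?thesis using True by (simp add: measure_le_0_iff)
next
  case False
  then have pos: "\<P>(\<omega> in M. \<forall>i\<le>t. (X i \<omega>, Y i \<omega>) = s i) > 0"
    by (simp add: path_event_def state_def zero_less_measure_iff)
  have "{\<omega> \<in> space M. (X (Suc t) \<omega>, Y (Suc t) \<omega>) = s (Suc t) \<and> (\<forall>i\<le>t. (X i \<omega>, Y i \<omega>) = s i)}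
      = path_event (Suc t) s"
    by (auto simp: path_event_def state_def le_Suc_eq)
  then show ?thesis
    using markov[OF pos, of "s (Suc t)"] pos
    by (simp add: cond_prob_def path_event_def state_def field_simps)
qed

lemma path_event_state_nonzero:
  "prob (path_event t s) > 0 \<Longrightarrow> s t \<noteq> (0, 0)"
proof (cases t)
  case 0
  assume "prob (path_event t s) > 0"
  moreover have "prob (path_event 0 s) = 0" if "s 0 \<noteq> (int z0, 0)"
  proof -
    have "AE \<omega> in M. \<omega> \<notin> path_event 0 s"
      using start
    proof eventually_elim
      case (elim \<omega>)
      then show ?case using that by (auto simp: path_event_def state_def)
    qed
    then show ?thesis by (simp add: prob_eq_0)
  qed
  ultimately show ?thesis using z0_pos 0 by force
next
  case (Suc t')
  assume "prob (path_event t s) > 0"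
  then have "urn_kernel (s t') (s t) > 0"
    unfolding Suc prob_path_event_Suc by (simp add: zero_less_mult_iff measure_le_0_iff not_less)
  then show ?thesis by (rule urn_kernel_pos_imp_nonzero)
qed

text \<open>The event whose probability is \<open>exit_prob\<close>; the time bound N makes
  induction over the first step possible.\<close>

definition exits :: "nat \<Rightarrow> nat \<Rightarrow> nat \<Rightarrow> 'a \<Rightarrow> bool" where
  "exits N m t \<omega> \<longleftrightarrow> (\<exists>n\<in>{t<..t + N}. on_axis (state n \<omega>) \<and> (\<forall>j\<in>{t<..<n}. \<not> on_axis (state j \<omega>))
     \<and> level (state n \<omega>) \<le> m)"

lemma pred_exits [measurable]: "Measurable.pred M (exits N m t)"
  unfolding exits_def by measurable

lemma exits_0: "\<not> exits 0 m t \<omega>"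
  by (simp add: exits_def)

lemma exits_Suc:
  "exits (Suc N) m t \<omega> \<longleftrightarrow>
     (if on_axis (state (Suc t) \<omega>) then level (state (Suc t) \<omega>) \<le> m else exits N m (Suc t) \<omega>)"
proof (cases "on_axis (state (Suc t) \<omega>)")
  case True
  have "n = Suc t" if "n \<in> {t<..t + Suc N}" "\<forall>j\<in>{t<..<n}. \<not> on_axis (state j \<omega>)" for n
    using that True by (metis Suc_lessI greaterThanAtMost_iff greaterThanLessThan_iff lessI)
  moreover have "Suc t \<in> {t<..t + Suc N}" "{t<..<Suc t} = {}" by auto
  ultimately show ?thesis
    unfolding exits_def using True by (metis empty_iff)
next
  case False
  have "{t<..t + Suc N} = insert (Suc t) {Suc t<..Suc t + N}" by auto
  moreover have "{t<..<n} = insert (Suc t) {Suc t<..<n}" if "n \<in> {Suc t<..Suc t + N}" for n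
    using that by auto
  ultimately show ?thesis
    unfolding exits_def using False by auto
qed

text \<open>First-step analysis by induction on N, with the history extended by the next state.
  Multiplying by the probability of the history avoids conditioning on null events.\<close>

lemma prob_path_event_exits:
  assumes "s t \<noteq> (0, 0)"
  shows "\<P>(\<omega> in M. \<omega> \<in> path_event t s \<and> exits N m t \<omega>) =
    prob (path_event t s) * exit_prob N m (descent (s t)) (ascent (s t))"
  using assms
proof (induction N arbitrary: t s)
  case 0
  then show ?case by (simp add: exits_0)
next
  case (Suc N)
  let ?p = "descent (s t)" and ?q = "ascent (s t)"
  let ?A = "path_event t s"
  obtain up down where ud: "up \<noteq> down"
    "urn_kernel (s t) up = real ?p / (real ?p + real ?q)"
    "urn_kernel (s t) down = real ?q / (real ?p + real ?q)"
    "\<not> on_axis up" "descent up = ?p" "ascent up = Suc ?q"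
    "?q > 0 \<longrightarrow> (on_axis down \<longleftrightarrow> ?p = 1)"
    "?q > 0 \<and> ?p = 1 \<longrightarrow> level down = ?q"
    "?q > 0 \<and> ?p \<noteq> 1 \<longrightarrow> descent down = ?p - 1 \<and> ascent down = ?q"
    by (rule urn_kernel_step[OF Suc.prems])
  define B where "B v = path_event (Suc t) (s(Suc t := v))" for v
  have B_iff: "\<omega> \<in> B v \<longleftrightarrow> \<omega> \<in> ?A \<and> state (Suc t) \<omega> = v" for \<omega> v
    by (auto simp: B_def path_event_def le_Suc_eq)
  have B_sets [measurable]: "B v \<in> sets M" for v by (simp add: B_def path_event_sets)
  have pB: "prob (B v) = prob ?A * urn_kernel (s t) v" for v
  proof -
    have "path_event t (s(Suc t := v)) = ?A" by (auto simp: path_event_def)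
    then show ?thesis
      unfolding B_def prob_path_event_Suc by simp
  qed
  have IH: "\<P>(\<omega> in M. \<omega> \<in> B v \<and> exits N m (Suc t) \<omega>) = prob (B v) * exit_prob N m (descent v) (ascent v)"
    if "v \<noteq> (0, 0)" for v
    using Suc.IH[of "s(Suc t := v)" "Suc t"] that by (simp add: B_def fun_upd_def)
  define E where "E = {\<omega> \<in> space M. exits (Suc N) m t \<omega>}"
  have E [measurable]: "E \<in> sets M" unfolding E_def by measurable
  have p_pos: "?p > 0" using descent_pos Suc.prems by blast
  \<comment> \<open>The two successors exhaust the probability of the history, so all other
    continuations are null.\<close>
  have "real ?p / (real ?p + real ?q) + real ?q / (real ?p + real ?q) = 1"
    using p_pos by (simp add: add_divide_distrib[symmetric])
  then have "prob (B up) + prob (B down) = prob ?A"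
    unfolding pB ud(2,3) by (metis distrib_left mult.right_neutral)
  moreover have "prob (B up \<union> B down) = prob (B up) + prob (B down)"
    using ud(1) by (intro finite_measure_Union) (auto simp: B_iff)
  moreover have "prob (?A - (B up \<union> B down)) = prob ?A - prob (B up \<union> B down)"
    by (intro finite_measure_Diff) (auto simp: B_iff)
  ultimately have rest: "prob (?A - (B up \<union> B down)) = 0" by simp
  have "prob (?A \<inter> E) = prob (B up \<inter> E \<union> B down \<inter> E)"
  proof -
    have "prob (?A \<inter> E - (B up \<union> B down)) = 0"
      using rest finite_measure_mono[of "?A \<inter> E - (B up \<union> B down)" "?A - (B up \<union> B down)"]
      by (auto simp: measure_le_0_iff)
    moreover have "prob (?A \<inter> E) = prob (?A \<inter> E - (B up \<union> B down)) + prob (B up \<inter> E \<union> B down \<inter> E)"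
      by (subst finite_measure_Union[symmetric]) (auto simp: B_iff intro!: arg_cong[where f = prob])
    ultimately show ?thesis by simp
  qed
  also have "\<dots> = prob (B up \<inter> E) + prob (B down \<inter> E)"
    using ud(1) by (intro finite_measure_Union) (auto simp: B_iff)
  also have "prob (B up \<inter> E) = prob (B up) * exit_prob N m ?p (Suc ?q)"
  proof -
    have "B up \<inter> E = {\<omega> \<in> space M. \<omega> \<in> B up \<and> exits N m (Suc t) \<omega>}"
      using ud(4) by (auto simp: B_iff E_def exits_Suc)
    moreover have "up \<noteq> (0, 0)" using ud(4) by (auto simp: on_axis_def)
    ultimately show ?thesis
      using IH[of up] ud(5,6) by simp
  qed
  also have "prob (B down \<inter> E) = prob (B down) *
      (if ?p = 1 then (if ?q \<le> m then 1 else 0) else exit_prob N m (?p - 1) ?q)"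
  proof (cases "?q = 0")
    case True
    then have "prob (B down) = 0" by (simp add: pB ud(3))
    then show ?thesis
      using finite_measure_mono[of "B down \<inter> E" "B down"] by (simp add: measure_le_0_iff)
  next
    case False
    show ?thesis
    proof (cases "?p = 1")
      case True
      then have "B down \<inter> E = (if ?q \<le> m then B down else {})"
        using ud(7,8) False by (auto simp: B_iff E_def exits_Suc path_event_def)
      then show ?thesis using True by simp
    next
      case p: False
      have "B down \<inter> E = {\<omega> \<in> space M. \<omega> \<in> B down \<and> exits N m (Suc t) \<omega>}"
        using ud(7) False p by (auto simp: B_iff E_def exits_Suc)
      moreover have "down \<noteq> (0, 0)" using ud(7) p False by (auto simp: on_axis_def)
      ultimately show ?thesis
        using IH[of down] ud(9) p False by simp
    qed
  qed
  finally have "prob (?A \<inter> E) = prob ?A * exit_prob (Suc N) m ?p ?q"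
    unfolding pB ud(2,3) exit_prob.simps by (simp only: distrib_left mult.assoc)
  moreover have "?A \<inter> E = {\<omega> \<in> space M. \<omega> \<in> ?A \<and> exits (Suc N) m t \<omega>}"
    by (auto simp: E_def)
  ultimately show ?case by simp
qed

definition eventually_exits :: "nat \<Rightarrow> nat \<Rightarrow> 'a \<Rightarrow> bool" where
  "eventually_exits m t \<omega> \<longleftrightarrow> (\<exists>N. exits N m t \<omega>)"

lemma pred_eventually_exits [measurable]: "Measurable.pred M (eventually_exits m t)"
  unfolding eventually_exits_def by measurable

text \<open>The events increase with N, and by \<open>exit_prob_eq\<close> their probabilities are
  constant from some N on.\<close>

lemma prob_path_event_eventually_exits:
  assumes "s t \<noteq> (0, 0)" "ascent (s t) \<le> Suc m"
  shows "\<P>(\<omega> in M. \<omega> \<in> path_event t s \<and> eventually_exits m t \<omega>) =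
    prob (path_event t s) * (1 - exit_tail m (descent (s t)) (ascent (s t)))"
proof -
  let ?p = "descent (s t)" and ?q = "ascent (s t)"
  define C where "C N = {\<omega> \<in> space M. \<omega> \<in> path_event t s \<and> exits N m t \<omega>}" for N
  have [measurable]: "C N \<in> sets M" for N unfolding C_def by measurable
  have "exits N m t \<omega> \<Longrightarrow> N \<le> N' \<Longrightarrow> exits N' m t \<omega>" for N N' \<omega>
    unfolding exits_def by fastforce
  then have "incseq C"
    by (auto simp: C_def incseq_def)
  then have lim: "(\<lambda>N. prob (C N)) \<longlonglongrightarrow> prob (\<Union>N. C N)"
    by (intro finite_Lim_measure_incseq) auto
  have ev: "\<forall>\<^sub>F N in sequentially. prob (C N) = prob (path_event t s) * (1 - exit_tail m ?p ?q)"
    using eventually_ge_at_top[of "?p + (Suc m - ?q)"]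
  proof eventually_elim
    case (elim N)
    have "exit_prob N m ?p ?q = 1 - exit_tail m ?p ?q"
      using elim assms(2) descent_pos[OF assms(1)] by (intro exit_prob_eq) auto
    then show ?case
      unfolding C_def using prob_path_event_exits[of s t N m, OF assms(1)] by simp
  qed
  have "prob (\<Union>N. C N) = prob (path_event t s) * (1 - exit_tail m ?p ?q)"
    by (rule LIMSEQ_unique[OF lim tendsto_eventually[OF ev]])
  moreover have "(\<Union>N. C N) = {\<omega> \<in> space M. \<omega> \<in> path_event t s \<and> eventually_exits m t \<omega>}"
    by (auto simp: C_def eventually_exits_def)
  ultimately show ?thesis by simp
qed

section \<open>Almost sure return to the axes\<close>

definition returns_after :: "nat \<Rightarrow> 'a \<Rightarrow> bool" where
  "returns_after t \<omega> \<longleftrightarrow> (\<exists>n>t. on_axis (state n \<omega>))"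

lemma pred_returns_after [measurable]: "Measurable.pred M (returns_after t)"
  unfolding returns_after_def by measurable

text \<open>Given the history, a return at distance at most m has probability
  \<open>1 - exit_tail m ?p ?q\<close> for large m, which tends to 1.\<close>

lemma AE_path_event_returns: "AE \<omega> in M. \<omega> \<in> path_event t s \<longrightarrow> returns_after t \<omega>"
proof (cases "prob (path_event t s) = 0")
  case True
  then have "AE \<omega> in M. \<omega> \<notin> path_event t s" by (simp add: prob_eq_0)
  then show ?thesis by eventually_elim simp
next
  case False
  then have nz: "s t \<noteq> (0, 0)"
    by (intro path_event_state_nonzero) (simp add: zero_less_measure_iff)
  let ?p = "descent (s t)" and ?q = "ascent (s t)"
  let ?A = "path_event t s"
  define D where "D = {\<omega> \<in> space M. \<omega> \<in> ?A \<and> returns_after t \<omega>}"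
  have [measurable]: "D \<in> sets M" unfolding D_def by measurable
  have "(\<lambda>m. prob ?A * (1 - exit_tail m ?p ?q)) \<longlonglongrightarrow> prob ?A * (1 - 0)"
    by (intro tendsto_intros exit_tail_tendsto_0)
  moreover have "\<forall>\<^sub>F m in sequentially. prob ?A * (1 - exit_tail m ?p ?q) \<le> prob D"
    using eventually_ge_at_top[of ?q]
  proof eventually_elim
    case (elim m)
    have "prob ?A * (1 - exit_tail m ?p ?q) = \<P>(\<omega> in M. \<omega> \<in> ?A \<and> eventually_exits m t \<omega>)"
      using prob_path_event_eventually_exits[of s t m, OF nz] elim by simp
    also have "\<dots> \<le> prob D"
      by (intro finite_measure_mono)
         (auto simp: D_def eventually_exits_def exits_def returns_after_def)
    finally show ?case .
  qed
  ultimately have "prob ?A * (1 - 0) \<le> prob D"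
    by (intro tendsto_upperbound[OF _ _ sequentially_bot])
  moreover have "prob (?A - D) = prob ?A - prob D"
    by (intro finite_measure_Diff) (auto simp: D_def)
  ultimately have "prob (?A - D) = 0"
    using measure_nonneg[of M "?A - D"] by simp
  then have "AE \<omega> in M. \<omega> \<notin> ?A - D" by (simp add: prob_eq_0)
  then show ?thesis by eventually_elim (auto simp: D_def path_event_def)
qed

text \<open>A list, because there are only countably many lists of states: null sets can be united
  and probabilities summed over all histories.\<close>

definition history :: "nat \<Rightarrow> 'a \<Rightarrow> (int \<times> int) list" where
  "history t \<omega> = map (\<lambda>i. state i \<omega>) [0..<Suc t]"

lemma history_eq_iff:
  "history t \<omega> = h \<longleftrightarrow> length h = Suc t \<and> (\<forall>i\<le>t. state i \<omega> = h ! i)"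
  unfolding history_def list_eq_iff_nth_eq by (auto simp: less_Suc_eq_le simp del: upt_Suc)

lemma AE_returns_after: "AE \<omega> in M. returns_after t \<omega>"
proof -
  have "AE \<omega> in M. \<forall>h :: (int \<times> int) list. \<omega> \<in> path_event t ((!) h) \<longrightarrow> returns_after t \<omega>"
    unfolding AE_all_countable using AE_path_event_returns by blast
  with AE_space show ?thesis
  proof eventually_elim
    case (elim \<omega>)
    have "\<omega> \<in> path_event t ((!) (history t \<omega>))"
      using elim(1) history_eq_iff[of t \<omega> "history t \<omega>"] by (simp add: path_event_def)
    then show ?case using elim(2) by blast
  qed
qed

section \<open>The embedded chain at the axis times\<close>

lemma prob_cong_AE:
  assumes "AE \<omega> in M. P \<omega> \<longleftrightarrow> Q \<omega>" "Measurable.pred M P" "Measurable.pred M Q"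
  shows "\<P>(\<omega> in M. P \<omega>) = \<P>(\<omega> in M. Q \<omega>)"
proof (rule finite_measure_eq_AE)
  show "AE \<omega> in M. \<omega> \<in> {\<omega> \<in> space M. P \<omega>} \<longleftrightarrow> \<omega> \<in> {\<omega> \<in> space M. Q \<omega>}"
    using assms(1) by eventually_elim auto
  show "{\<omega> \<in> space M. P \<omega>} \<in> events" "{\<omega> \<in> space M. Q \<omega>} \<in> events"
    using assms(2,3) by measurable
qed

text \<open>With the history up to an axis time as \<open>W\<close>, summation over the partition
  passes from fixed times to that random time.\<close>

lemma prob_proportional_on_countable_partition:
  fixes W :: "'a \<Rightarrow> 'b::countable"
  assumes meas: "\<And>h. Measurable.pred M (\<lambda>\<omega>. W \<omega> = h)" "Measurable.pred M P" "Measurable.pred M Q"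
    and proportional: "\<And>h. \<P>(\<omega> in M. W \<omega> = h \<and> P \<omega>) = c * \<P>(\<omega> in M. W \<omega> = h \<and> Q \<omega>)"
  shows "\<P>(\<omega> in M. P \<omega>) = c * \<P>(\<omega> in M. Q \<omega>)"
proof -
  define A where "A R i = {\<omega> \<in> space M. to_nat (W \<omega>) = i \<and> R \<omega>}" for R i
  have A: "A R (to_nat h) = {\<omega> \<in> space M. W \<omega> = h \<and> R \<omega>}" for R h
    by (auto simp: A_def)
  have A_empty: "A R i = {}" if "i \<notin> range (to_nat :: 'b \<Rightarrow> nat)" for R i
    using that by (auto simp: A_def)
  have sums: "(\<lambda>i. prob (A R i)) sums \<P>(\<omega> in M. R \<omega>)" if [measurable]: "Measurable.pred M R" for R
  proof -
    have "A R i \<in> sets M" for i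
    proof (cases "i \<in> range (to_nat :: 'b \<Rightarrow> nat)")
      case True
      then obtain h :: 'b where "i = to_nat h" by blast
      then show ?thesis using meas(1)[of h] that by (simp add: A)
    qed (simp add: A_empty)
    then have "(\<lambda>i. prob (A R i)) sums prob (\<Union>i. A R i)"
      by (intro finite_measure_UNION) (auto simp: disjoint_family_on_def A_def)
    moreover have "(\<Union>i. A R i) = {\<omega> \<in> space M. R \<omega>}" by (auto simp: A_def)
    ultimately show ?thesis by simp
  qed
  have "prob (A P i) = c * prob (A Q i)" for i
  proof (cases "i \<in> range (to_nat :: 'b \<Rightarrow> nat)")
    case True
    then obtain h :: 'b where "i = to_nat h" by blast
    then show ?thesis using proportional[of h] by (simp add: A)
  qed (simp add: A_empty)
  then have "(\<lambda>i. c * prob (A Q i)) sums \<P>(\<omega> in M. P \<omega>)"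
    using sums[OF meas(2)] by simp
  then show ?thesis
    using sums_mult[OF sums[OF meas(3)], of c] by (rule sums_unique2)
qed

text \<open>Such paths have full measure, and on them the \<open>LEAST\<close> in
  \<open>axis_time\<close> is attained. The condition at time 0 covers \<open>k = 0\<close>, where
  \<open>axis_time\<close> is 0.\<close>

definition recurrent_path :: "'a \<Rightarrow> bool" where
  "recurrent_path \<omega> \<longleftrightarrow> on_axis (state 0 \<omega>) \<and> (\<forall>t. returns_after t \<omega>)"

lemma AE_recurrent_path: "AE \<omega> in M. recurrent_path \<omega>"
proof -
  have "AE \<omega> in M. \<forall>t. returns_after t \<omega>"
    unfolding AE_all_countable using AE_returns_after by blast
  with start show ?thesis
    by eventually_elim (simp add: recurrent_path_def on_axis_def state_def)
qed

abbreviation "\<tau> \<equiv> axis_time X Y"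

abbreviation "Z \<equiv> embedded X Y"

lemma axis_time_Suc_Least: "\<tau> (Suc k) \<omega> = (LEAST n. n > \<tau> k \<omega> \<and> on_axis (state n \<omega>))"
  by (simp add: on_axis_def state_def)

lemma embedded_eq_level: "Z k \<omega> = level (state (\<tau> k \<omega>) \<omega>)"
  by (simp add: embedded_def level_def state_def)

lemma axis_time_Suc:
  assumes "recurrent_path \<omega>"
  shows "\<tau> k \<omega> < \<tau> (Suc k) \<omega>" "on_axis (state (\<tau> (Suc k) \<omega>) \<omega>)"
    "\<And>n. \<tau> k \<omega> < n \<Longrightarrow> n < \<tau> (Suc k) \<omega> \<Longrightarrow> \<not> on_axis (state n \<omega>)"
proof -
  have "\<exists>n. n > \<tau> k \<omega> \<and> on_axis (state n \<omega>)"
    using assms by (auto simp: recurrent_path_def returns_after_def)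
  from LeastI_ex[OF this] show "\<tau> k \<omega> < \<tau> (Suc k) \<omega>" "on_axis (state (\<tau> (Suc k) \<omega>) \<omega>)"
    unfolding axis_time_Suc_Least by auto
  show "\<not> on_axis (state n \<omega>)" if "\<tau> k \<omega> < n" "n < \<tau> (Suc k) \<omega>" for n
    using that not_less_Least[of n "\<lambda>n. n > \<tau> k \<omega> \<and> on_axis (state n \<omega>)"]
    unfolding axis_time_Suc_Least by auto
qed

lemma on_axis_axis_time: "recurrent_path \<omega> \<Longrightarrow> on_axis (state (\<tau> k \<omega>) \<omega>)"
  by (cases k) (simp_all add: axis_time_Suc(2) recurrent_path_def del: axis_time.simps(2))

text \<open>The stopping time property: whether \<open>\<tau> k\<close> equals t depends only on the
  path up to t.\<close>

lemma axis_time_cong: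
  assumes "recurrent_path \<omega>" "recurrent_path \<omega>'" "\<And>i. i \<le> \<tau> k \<omega> \<Longrightarrow> state i \<omega>' = state i \<omega>"
  shows "\<tau> k \<omega>' = \<tau> k \<omega>"
  using assms(3)
proof (induction k)
  case (Suc k)
  note lt = axis_time_Suc[OF assms(1), of k]
  have IH: "\<tau> k \<omega>' = \<tau> k \<omega>"
    using lt(1) Suc.prems by (intro Suc.IH) (simp del: axis_time.simps(2))
  show ?case
    unfolding axis_time_Suc_Least[of k \<omega>']
  proof (rule Least_equality)
    show "\<tau> k \<omega>' < \<tau> (Suc k) \<omega> \<and> on_axis (state (\<tau> (Suc k) \<omega>) \<omega>')"
      using IH lt(1,2) Suc.prems by (simp del: axis_time.simps(2))
    fix n assume n: "\<tau> k \<omega>' < n \<and> on_axis (state n \<omega>')"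
    show "\<tau> (Suc k) \<omega> \<le> n"
    proof (rule ccontr)
      assume "\<not> \<tau> (Suc k) \<omega> \<le> n"
      then show False using n IH lt(3)[of n] Suc.prems[of n] by (simp del: axis_time.simps(2))
    qed
  qed
qed simp

lemma eventually_exits_iff:
  assumes "recurrent_path \<omega>"
  shows "eventually_exits m (\<tau> k \<omega>) \<omega> \<longleftrightarrow> Z (Suc k) \<omega> \<le> m"
proof -
  let ?t = "\<tau> k \<omega>" and ?t' = "\<tau> (Suc k) \<omega>"
  note nxt = axis_time_Suc[OF assms, of k]
  have "n = ?t'" if "?t < n" "on_axis (state n \<omega>)" "\<forall>j\<in>{?t<..<n}. \<not> on_axis (state j \<omega>)" for n
    using that nxt by (metis greaterThanLessThan_iff linorder_neqE_nat)
  moreover have "?t' \<in> {?t<..?t + (?t' - ?t)}" using nxt(1) by (simp del: axis_time.simps(2))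
  moreover have "\<forall>j\<in>{?t<..<?t'}. \<not> on_axis (state j \<omega>)" using nxt(3) by (simp del: axis_time.simps(2))
  ultimately show ?thesis
    unfolding eventually_exits_def exits_def embedded_eq_level using nxt(2)
    by (metis greaterThanAtMost_iff)
qed

lemma measurable_axis_time [measurable]: "\<tau> k \<in> M \<rightarrow>\<^sub>M count_space UNIV"
proof (induction k)
  case (Suc k)
  note [measurable] = Suc
  show ?case
    unfolding axis_time_Suc_Least[abs_def] by measurable
qed simp

lemma measurable_embedded [measurable]: "Z k \<in> M \<rightarrow>\<^sub>M count_space UNIV"
proof -
  have "(\<lambda>\<omega>. (\<lambda>i \<omega>. level (state i \<omega>)) (\<tau> k \<omega>) \<omega>) \<in> M \<rightarrow>\<^sub>M count_space UNIV"
    by (rule measurable_compose_countable) measurable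
  then show ?thesis by (simp add: embedded_eq_level[abs_def])
qed

lemma pred_history_axis_time [measurable]: "Measurable.pred M (\<lambda>\<omega>. history (\<tau> k \<omega>) \<omega> = h)"
  unfolding history_eq_iff by measurable

text \<open>Strong Markov property at \<open>\<tau> k\<close>: the event is split by the history up
  to this random time, and each relevant history fixes a deterministic time and a state on an axis
  at distance n.\<close>

lemma prob_embedded_Suc_le:
  assumes "n \<ge> 1"
  shows "\<P>(\<omega> in M. Z k \<omega> = n \<and> Z (Suc k) \<omega> \<le> m) = (1 - exit_tail m n 1) * \<P>(\<omega> in M. Z k \<omega> = n)"
proof (rule prob_proportional_on_countable_partition[where W = "\<lambda>\<omega>. history (\<tau> k \<omega>) \<omega>"])
  fix h
  show "\<P>(\<omega> in M. history (\<tau> k \<omega>) \<omega> = h \<and> Z k \<omega> = n \<and> Z (Suc k) \<omega> \<le> m)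
    = (1 - exit_tail m n 1) * \<P>(\<omega> in M. history (\<tau> k \<omega>) \<omega> = h \<and> Z k \<omega> = n)"
  proof (cases "\<exists>\<omega>\<^sub>0. recurrent_path \<omega>\<^sub>0 \<and> history (\<tau> k \<omega>\<^sub>0) \<omega>\<^sub>0 = h \<and> Z k \<omega>\<^sub>0 = n")
    \<comment> \<open>A history that arises from no recurrent path with \<open>Z k = n\<close>
      contributes 0 to both sides.\<close>
    case False
    have "\<P>(\<omega> in M. history (\<tau> k \<omega>) \<omega> = h \<and> Z k \<omega> = n) = \<P>(\<omega> in M. False)"
      by (rule prob_cong_AE) (use AE_recurrent_path False in auto)
    moreover have "\<P>(\<omega> in M. history (\<tau> k \<omega>) \<omega> = h \<and> Z k \<omega> = n \<and> Z (Suc k) \<omega> \<le> m) = \<P>(\<omega> in M. False)"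
      by (rule prob_cong_AE) (use AE_recurrent_path False in auto)
    ultimately show ?thesis by simp
  next
    case True
    then obtain \<omega>\<^sub>0 where \<omega>\<^sub>0: "recurrent_path \<omega>\<^sub>0" "history (\<tau> k \<omega>\<^sub>0) \<omega>\<^sub>0 = h" "Z k \<omega>\<^sub>0 = n" by blast
    define t where "t = \<tau> k \<omega>\<^sub>0"
    have h: "length h = Suc t" "\<And>i. i \<le> t \<Longrightarrow> h ! i = state i \<omega>\<^sub>0"
      using \<omega>\<^sub>0(2) by (auto simp: history_eq_iff t_def)
    have axis: "on_axis (h ! t)" using on_axis_axis_time[OF \<omega>\<^sub>0(1), of k] h(2) by (simp add: t_def)
    have level: "level (h ! t) = n" using \<omega>\<^sub>0(3) h(2) by (simp add: embedded_eq_level t_def)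
    have nz: "h ! t \<noteq> (0, 0)" using level assms by (auto simp: level_def)
    have iff: "history (\<tau> k \<omega>) \<omega> = h \<and> Z k \<omega> = n \<longleftrightarrow> \<omega> \<in> path_event t ((!) h)"
      and time: "\<omega> \<in> path_event t ((!) h) \<Longrightarrow> \<tau> k \<omega> = t"
      if "recurrent_path \<omega>" "\<omega> \<in> space M" for \<omega>
    proof -
      show time: "\<tau> k \<omega> = t" if "\<omega> \<in> path_event t ((!) h)"
        unfolding t_def using that h(2) \<omega>\<^sub>0(1) \<open>recurrent_path \<omega>\<close>
        by (intro axis_time_cong) (auto simp: path_event_def t_def)
      show "history (\<tau> k \<omega>) \<omega> = h \<and> Z k \<omega> = n \<longleftrightarrow> \<omega> \<in> path_event t ((!) h)"
      proof
        assume "history (\<tau> k \<omega>) \<omega> = h \<and> Z k \<omega> = n"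
        then show "\<omega> \<in> path_event t ((!) h)"
          using h(1) \<open>\<omega> \<in> space M\<close> by (auto simp: history_eq_iff path_event_def)
      next
        assume *: "\<omega> \<in> path_event t ((!) h)"
        then show "history (\<tau> k \<omega>) \<omega> = h \<and> Z k \<omega> = n"
          using time[OF *] h(1) level by (auto simp: history_eq_iff path_event_def embedded_eq_level)
      qed
    qed
    have "\<P>(\<omega> in M. history (\<tau> k \<omega>) \<omega> = h \<and> Z k \<omega> = n) = \<P>(\<omega> in M. \<omega> \<in> path_event t ((!) h))"
    proof (rule prob_cong_AE)
      show "AE \<omega> in M. (history (\<tau> k \<omega>) \<omega> = h \<and> Z k \<omega> = n) = (\<omega> \<in> path_event t ((!) h))"
        using AE_recurrent_path AE_space by eventually_elim (rule iff)
    qed measurable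
    moreover have "\<P>(\<omega> in M. history (\<tau> k \<omega>) \<omega> = h \<and> Z k \<omega> = n \<and> Z (Suc k) \<omega> \<le> m)
        = \<P>(\<omega> in M. \<omega> \<in> path_event t ((!) h) \<and> eventually_exits m t \<omega>)"
    proof (rule prob_cong_AE)
      show "AE \<omega> in M. (history (\<tau> k \<omega>) \<omega> = h \<and> Z k \<omega> = n \<and> Z (Suc k) \<omega> \<le> m)
          = (\<omega> \<in> path_event t ((!) h) \<and> eventually_exits m t \<omega>)"
        using AE_recurrent_path AE_space
      proof eventually_elim
        case (elim \<omega>)
        then show ?case
          using iff[OF elim] time[OF elim] eventually_exits_iff[OF elim(1), of m k] by auto
      qed
    qed measurable
    moreover have "{\<omega> \<in> space M. \<omega> \<in> path_event t ((!) h)} = path_event t ((!) h)"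
      by (auto simp: path_event_def)
    moreover have "ascent (h ! t) = 0" "descent (h ! t) = n"
      using descent_on_axis[OF axis] ascent_on_axis[OF axis] level by auto
    ultimately show ?thesis
      using prob_path_event_eventually_exits[of "(!) h" t m, OF nz]
      by (simp add: exit_tail_from_axis)
  qed
qed measurable

lemma prob_embedded_Suc_gt:
  assumes "n \<ge> 1"
  shows "\<P>(\<omega> in M. Z k \<omega> = n \<and> m < Z (Suc k) \<omega>) = \<P>(\<omega> in M. Z k \<omega> = n) * exit_tail m n 1"
proof -
  have "\<P>(\<omega> in M. Z k \<omega> = n) = \<P>(\<omega> in M. Z k \<omega> = n \<and> Z (Suc k) \<omega> \<le> m) + \<P>(\<omega> in M. Z k \<omega> = n \<and> m < Z (Suc k) \<omega>)"
    by (subst finite_measure_Union[symmetric]) (auto intro!: arg_cong[where f = prob])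
  then show ?thesis
    using prob_embedded_Suc_le[OF assms, of k m] by (simp add: algebra_simps)
qed

text \<open>The expectation of \<open>f\<close> is the sum of its tail probabilities; convergence of
  that sum gives integrability.\<close>

lemma embedded_expectation:
  assumes "n \<ge> 1" "\<P>(\<omega> in M. Z k \<omega> = n) > 0"
  shows "set_integrable M {\<omega> \<in> space M. Z k \<omega> = n} (\<lambda>\<omega>. real (Z (Suc k) \<omega>))"
    "event_expectation M (\<lambda>\<omega>. real (Z (Suc k) \<omega>)) {\<omega> \<in> space M. Z k \<omega> = n} = renewal_coeff n - real n"
proof -
  define D where "D = {\<omega> \<in> space M. Z k \<omega> = n}"
  define f where "f \<omega> = (if Z k \<omega> = n then Z (Suc k) \<omega> else 0)" for \<omega>
  have [measurable]: "D \<in> sets M" "f \<in> M \<rightarrow>\<^sub>M count_space UNIV"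
    unfolding D_def f_def by measurable
  have ind: "indicator D \<omega> *\<^sub>R real (Z (Suc k) \<omega>) = real (f \<omega>)" if "\<omega> \<in> space M" for \<omega>
    using that by (simp add: D_def f_def indicator_def)
  have tail: "prob {\<omega> \<in> space M. m < f \<omega>} = prob D * exit_tail m n 1" for m
  proof -
    have "{\<omega> \<in> space M. m < f \<omega>} = {\<omega> \<in> space M. Z k \<omega> = n \<and> m < Z (Suc k) \<omega>}"
      by (auto simp: f_def)
    then show ?thesis using prob_embedded_Suc_gt[OF assms(1), of k m] by (simp add: D_def)
  qed
  have sums: "(\<lambda>m. prob {\<omega> \<in> space M. m < f \<omega>}) sums (prob D * (renewal_coeff n - real n))"
    unfolding tail by (intro sums_mult exit_tail_sums assms(1))
  have "(\<integral>\<^sup>+\<omega>. ennreal (real (f \<omega>)) \<partial>M) = (\<integral>\<^sup>+\<omega>. of_nat (f \<omega>) \<partial>M)"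
    by (simp add: ennreal_of_nat_eq_real_of_nat)
  also have "\<dots> = (\<Sum>m. ennreal (prob {\<omega> \<in> space M. m < f \<omega>}))"
    by (subst nn_integral_nat_function) (simp_all add: emeasure_eq_measure)
  also have "\<dots> = ennreal (prob D * (renewal_coeff n - real n))"
    using sums by (subst suminf_ennreal2) (auto simp: sums_iff)
  finally have nn: "(\<integral>\<^sup>+\<omega>. ennreal (real (f \<omega>)) \<partial>M) = ennreal (prob D * (renewal_coeff n - real n))" .
  have "prob D * (renewal_coeff n - real n) \<ge> 0"
    using sums_le[OF _ sums_zero sums] by simp
  then have "has_bochner_integral M (\<lambda>\<omega>. real (f \<omega>)) (prob D * (renewal_coeff n - real n))"
    by (intro has_bochner_integral_nn_integral nn) auto
  then have hbi: "has_bochner_integral M (\<lambda>\<omega>. indicator D \<omega> *\<^sub>R real (Z (Suc k) \<omega>)) (prob D * (renewal_coeff n - real n))"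
    by (rule has_bochner_integral_cong[THEN iffD2, rotated 3]) (auto simp: ind simp del: real_scaleR_def)
  then show "set_integrable M {\<omega> \<in> space M. Z k \<omega> = n} (\<lambda>\<omega>. real (Z (Suc k) \<omega>))"
    unfolding set_integrable_def D_def[symmetric] by (rule integrable.intros)
  from hbi have "(LINT \<omega>:D|M. real (Z (Suc k) \<omega>)) = prob D * (renewal_coeff n - real n)"
    unfolding set_lebesgue_integral_def by (rule has_bochner_integral_integral_eq)
  then show "event_expectation M (\<lambda>\<omega>. real (Z (Suc k) \<omega>)) {\<omega> \<in> space M. Z k \<omega> = n} = renewal_coeff n - real n"
    using assms(2) unfolding event_expectation_def D_def[symmetric] by simp
qed

end

theorem theorem2p2:
  fixes M :: "'a measure" and z0 :: nat and X Y :: "nat \<Rightarrow> 'a \<Rightarrow> int"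
  assumes "simple_harmonic_urn M z0 X Y"
  shows "\<exists>\<alpha>\<^sub>1 \<beta>\<^sub>1 :: real.
    Complex \<alpha>\<^sub>1 \<beta>\<^sub>1 \<in> char_roots \<and> (\<forall>l\<in>char_roots. Re l \<le> \<alpha>\<^sub>1) \<and>
    2.088843 \<le> - \<alpha>\<^sub>1 \<and> - \<alpha>\<^sub>1 < 2.088844 \<and> 7.461489 \<le> \<beta>\<^sub>1 \<and> \<beta>\<^sub>1 < 7.461490 \<and>
    (\<exists>m :: nat \<Rightarrow> real.
      (\<forall>k n. n \<ge> 1 \<longrightarrow> \<P>(\<omega> in M. embedded X Y k \<omega> = n) > 0 \<longrightarrow>
        set_integrable M {\<omega> \<in> space M. embedded X Y k \<omega> = n} (\<lambda>\<omega>. real (embedded X Y (k + 1) \<omega>)) \<and>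
        event_expectation M (\<lambda>\<omega>. real (embedded X Y (k + 1) \<omega>))
          {\<omega> \<in> space M. embedded X Y k \<omega> = n} = m n) \<and>
      (\<lambda>n. m n - (real n + 2 / 3)) \<in> O(\<lambda>n. exp (\<alpha>\<^sub>1 * real n)))"
proof -
  interpret simple_harmonic_urn M z0 X Y by fact
  obtain \<alpha> \<beta> where root: "Complex \<alpha> \<beta> \<in> char_roots" "\<forall>l\<in>char_roots. Re l \<le> \<alpha>"
    "2.088843 \<le> - \<alpha>" "- \<alpha> < 2.088844" "7.461489 \<le> \<beta>" "\<beta> < 7.461490"
    by (rule dominant_char_root)
  \<comment> \<open>A zero other than 1 is \<open>exp (- l)\<close> for a characteristic root l,
    hence of modulus \<open>exp (- Re l)\<close>.\<close>
  have "\<rho> = 1 \<or> exp (- \<alpha>) \<le> cmod \<rho>" if "renewal_denom \<rho> = 0" for \<rho>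
  proof (cases "\<rho> = 1")
    case False
    then have l: "1 - \<rho> \<in> char_roots" using that by (intro renewal_denom_zero_imp_char_root)
    then have "\<rho> = exp (- (1 - \<rho>))" by (simp add: char_roots_def)
    then have "cmod \<rho> = exp (- Re (1 - \<rho>))" by (metis norm_exp_eq_Re uminus_complex.sel(1))
    then show ?thesis using root(2) l by fastforce
  qed simp
  then have "(\<lambda>n. renewal_coeff n - (2 * real n + 2 / 3)) \<in> O(\<lambda>n. (1 / exp (- \<alpha>)) ^ n)"
    by (intro renewal_coeff_asymptotics) auto
  moreover have "(1 / exp (- \<alpha>)) ^ n = exp (\<alpha> * real n)" for n
    by (simp add: exp_minus divide_inverse exp_of_nat2_mult)
  ultimately have "(\<lambda>n. (renewal_coeff n - real n) - (real n + 2 / 3)) \<in> O(\<lambda>n. exp (\<alpha> * real n))"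
    by (simp add: algebra_simps)
  moreover have "set_integrable M {\<omega> \<in> space M. Z k \<omega> = n} (\<lambda>\<omega>. real (Z (k + 1) \<omega>)) \<and>
      event_expectation M (\<lambda>\<omega>. real (Z (k + 1) \<omega>)) {\<omega> \<in> space M. Z k \<omega> = n} = renewal_coeff n - real n"
    if "n \<ge> 1" "\<P>(\<omega> in M. Z k \<omega> = n) > 0" for k n
    using embedded_expectation[OF that] by simp
  ultimately show ?thesis
    using root by (intro exI[of _ \<alpha>] exI[of _ \<beta>] conjI exI[of _ "\<lambda>n. renewal_coeff n - real n"]) auto
qed

end
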